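(* Suppose $\mathcal{X}$ has finite base measure $\mu(\mathcal{X}) = 1$, and suppose the orthonormal basis $\{\psi_z\}_{z \in \mathbb{Z}^D}$ of $L^2(\mathcal{X},\mu)$ contains the constant function $\psi_0 = 1$ and is uniformly bounded, i.e. $\sup_{z} \|\psi_z\|_\infty < \infty$. For $\zeta \ge 0$ define $Z_\zeta := \{z \in \mathbb{Z}^D : \|z\|_\infty \leq \zeta\}$, $A_\zeta := \sum_{z \in Z_\zeta} a_z^{-2}$ and $B_\zeta := \sum_{z \in Z_\zeta} b_z^{-2}$. (1) If $B_\zeta \in \Omega(\zeta^{2D})$ as $\zeta \to \infty$, then, as $n \to \infty$, $$\inf_{\hat S} \sup_{\|h\|_b \leq 1} \mathbb{E}\left[ \left( \hat S - \|h\|_a^2 \right)^2 \right] \in \Omega\left( \max\left\{ \frac{A_{\zeta_n}^2}{B_{\zeta_n}^2},\, n^{-1} \right\} \right),$$ where $\zeta_n$ is chosen to satisfy $B_{\zeta_n}^2 \asymp \zeta_n^D n^2$. (2) If $B_\zeta \in o(\zeta^{2D})$ as $\zeta \to \infty$, then, as $n \to \infty$, $$\inf_{\hat S} \sup_{\|h\|_b \leq 1} \mathbb{E}\left[ \left( \hat S - \|h\|_a^2 \right)^2 \right] \in \Omega\left( \max\left\{ \frac{A_{n^{2/(3D)}}^2}{n^{8/3}},\, n^{-1} \right\} \right).$$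
   Context: $\mathcal{X} \subseteq \mathbb{R}^D$ is a compact sample space with base measure $\mu$. $a = \{a_z\}_{z \in \mathbb{Z}^D}$ and $b = \{b_z\}_{z \in \mathbb{Z}^D}$ are families of positive real numbers. For $f \in L^2(\mathcal{X},\mu)$ write $\tilde f_z := \int_{\mathcal{X}} f \, \overline{\psi_z}\, d\mu$ and $$\|f\|_a^2 := \sum_{z \in \mathbb{Z}^D} \frac{|\tilde f_z|^2}{a_z^2}, \qquad \|f\|_b^2 := \sum_{z \in \mathbb{Z}^D} \frac{|\tilde f_z|^2}{b_z^2}.$$ Let $\mathcal{H}_a = \{f \in L^2(\mathcal{X},\mu) : \|f\|_a < \infty\}$ and similarly $\mathcal{H}_b$; it is assumed that $\mathcal{H}_b \subseteq \mathcal{H}_a$. The supremum is over probability densities $h$ on $\mathcal{X}$ with respect to $\mu$ (i.e. $h \ge 0$, $\int h\, d\mu = 1$) with $\|h\|_b \leq 1$; the expectation is over $n$ i.i.d. samples $X_1,\dots,X_n$ drawn from $h$; and the infimum is over all estimators $\hat S$, i.e. all functions of $X_1,\dots,X_n$. The notation $\asymp$ denotes equality up to constant factors, and $f \in \Omega(g)$ means $f \ge c g$ eventually for some constant $c>0$.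
   Formalization: Added: b_0 > 1 (else the density class is empty or {1}); each conjugate of ψ_z equals some ψ_w with ‖w‖_∞ = ‖z‖_∞ (automatic for real bases, true for Fourier; for some complex bases the claim fails without it); and ζ_n → ∞ explicitly. *)

theory Defs
  imports "HOL-Probability.Probability" "HOL-Library.Landau_Symbols"
begin

text \<open>Elements of L2 are represented by functions rather than by almost-everywhere classes;
  everything below depends on them only up to null sets.\<close>

definition L2 :: "'a measure \<Rightarrow> ('a \<Rightarrow> complex) set" where
  "L2 M = {f \<in> borel_measurable M. integrable M (\<lambda>x. (cmod (f x))\<^sup>2)}"

definition coeff :: "'a measure \<Rightarrow> ('i \<Rightarrow> 'a \<Rightarrow> complex) \<Rightarrow> ('a \<Rightarrow> complex) \<Rightarrow> 'i \<Rightarrow> complex" where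
  "coeff M \<psi> f z = (LINT x|M. f x * cnj (\<psi> z x))"

text \<open>Completeness is the third conjunct: every \<open>f\<close> is the unconditional limit of its
  expansion in the L2 norm.\<close>

definition orthonormal_basis :: "'a measure \<Rightarrow> ('i \<Rightarrow> 'a \<Rightarrow> complex) \<Rightarrow> bool" where
  "orthonormal_basis M \<psi> \<longleftrightarrow>
     (\<forall>z. \<psi> z \<in> L2 M) \<and>
     (\<forall>z w. coeff M \<psi> (\<psi> w) z = (if z = w then 1 else 0)) \<and>
     (\<forall>f\<in>L2 M. ((\<lambda>F. LINT x|M. (cmod (f x - (\<Sum>z\<in>F. coeff M \<psi> f z * \<psi> z x)))\<^sup>2)
                   \<longlongrightarrow> 0) (finite_subsets_at_top UNIV))"

text \<open>The squared norm with weights \<open>a\<close>, with values in the extended nonnegative reals, so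
  that a divergent series has the value \<open>\<infinity>\<close>.\<close>

definition wnorm2 ::
  "'a measure \<Rightarrow> ('i \<Rightarrow> 'a \<Rightarrow> complex) \<Rightarrow> ('i \<Rightarrow> real) \<Rightarrow> ('a \<Rightarrow> complex) \<Rightarrow> ennreal" where
  "wnorm2 M \<psi> a f = (\<Sum>\<^sub>\<infinity>z. ennreal ((cmod (coeff M \<psi> f z))\<^sup>2 / (a z)\<^sup>2))"

definition wspace ::
  "'a measure \<Rightarrow> ('i \<Rightarrow> 'a \<Rightarrow> complex) \<Rightarrow> ('i \<Rightarrow> real) \<Rightarrow> ('a \<Rightarrow> complex) set" where
  "wspace M \<psi> a = {f \<in> L2 M. wnorm2 M \<psi> a f < \<infinity>}"

definition density_ball ::
  "'a measure \<Rightarrow> ('i \<Rightarrow> 'a \<Rightarrow> complex) \<Rightarrow> ('i \<Rightarrow> real) \<Rightarrow> ('a \<Rightarrow> real) set" where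
  "density_ball M \<psi> b =
     {h \<in> borel_measurable M.
        (\<forall>x\<in>space M. 0 \<le> h x) \<and> (\<integral>\<^sup>+x. ennreal (h x) \<partial>M) = 1 \<and>
        (\<lambda>x. complex_of_real (h x)) \<in> L2 M \<and>
        wnorm2 M \<psi> b (\<lambda>x. complex_of_real (h x)) \<le> 1}"

text \<open>The sample \<open>(x 0, \<dots>, x (n - 1))\<close> has the \<open>n\<close>-fold product law of the density \<open>h\<close>.
  Estimators are the measurable real functions of the sample. The use of \<open>enn2real\<close> is harmless
  when the space for \<open>b\<close> is contained in the space for \<open>a\<close>: the \<open>a\<close>-norm of \<open>h\<close> is then finite.\<close>

definition minimax_risk ::
  "'a measure \<Rightarrow> ('i \<Rightarrow> 'a \<Rightarrow> complex) \<Rightarrow> ('i \<Rightarrow> real) \<Rightarrow> ('i \<Rightarrow> real) \<Rightarrow> nat \<Rightarrow> ennreal" where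
  "minimax_risk M \<psi> a b n =
     (INF S \<in> (borel_measurable (Pi\<^sub>M {..<n} (\<lambda>_. M)) :: ((nat \<Rightarrow> 'a) \<Rightarrow> real) set).
      SUP h \<in> density_ball M \<psi> b.
        \<integral>\<^sup>+x. ennreal ((S x - enn2real (wnorm2 M \<psi> a (\<lambda>y. complex_of_real (h y))))\<^sup>2)
          \<partial>(Pi\<^sub>M {..<n} (\<lambda>_. density M (\<lambda>y. ennreal (h y)))))"

definition freq_norm :: "int ^ 'd \<Rightarrow> real" where
  "freq_norm z = infnorm (\<chi> i. real_of_int (z $ i))"

definition cutoff_sum :: "(int ^ 'd \<Rightarrow> real) \<Rightarrow> real \<Rightarrow> real" where
  "cutoff_sum a \<zeta> = (\<Sum>z\<in>{z. freq_norm z \<le> \<zeta>}. 1 / (a z)\<^sup>2)"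

end

theory Submission
  imports Defs
begin

text \<open>
  The lower bound is a testing argument. By Le Cam's method (\<open>le_cam_mixture\<close>), the risk is at
  least of the order of the squared difference between two values of the functional, whenever the
  samples from a density with the first value cannot be distinguished from a mixture of samples from
  densities with the second value. Indistinguishability is measured by the chi-square divergence,
  which factorises over independent samples.

  For the first entry of each maximum, the reference is the constant density 1. The alternatives put
  a coefficient \<open>\<plusminus>g\<close> at each of the \<open>N\<close> nonzero frequencies up to \<open>\<zeta>\<close>, where \<open>N\<close> is at most of order
  \<open>\<zeta> ^ CARD('d)\<close>. Their squared \<open>a\<close>-norm exceeds that of the constant by \<open>g\<^sup>2\<close> times essentially
  \<open>cutoff_sum a \<zeta>\<close>, so the risk is at least of order \<open>g ^ 4 * (cutoff_sum a \<zeta>)\<^sup>2\<close>. Three constraints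
  limit \<open>g\<close>: the density must be nonnegative, which holds for \<open>g * N\<close> small since the basis is
  uniformly bounded; it must lie in the ball, which needs \<open>g\<^sup>2 * cutoff_sum b \<zeta>\<close> small; and random
  signs make the mixture indistinguishable from the constant density if \<open>n\<^sup>2 * g ^ 4 * N\<close> is small
  (\<open>minimax_risk_ge_signs\<close>). If \<open>cutoff_sum b\<close> grows at least like \<open>\<zeta> ^ (2 * CARD('d))\<close>, the ball
  constraint implies positivity, and \<open>g\<^sup>2\<close> of order \<open>1 / cutoff_sum b \<zeta>\<close> satisfies all three for the
  prescribed \<open>\<zeta>\<close>. If it grows more slowly, positivity implies the ball constraint, and the best
  choice is \<open>g\<close> of order \<open>\<zeta> ^ (- CARD('d))\<close>, with \<open>\<zeta> ^ CARD('d)\<close> of order \<open>n\<close> to the power \<open>2 / 3\<close>.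

  The rate \<open>1 / n\<close> comes from two densities that differ only in the coefficients of one conjugate
  pair of frequencies (\<open>minimax_risk_ge_two_point\<close>).

  A density must be real, so conjugate frequencies carry the same real coefficient. The condition
  \<open>b 0 > 1\<close> says that the constant density lies in the interior of the ball.
\<close>

section \<open>Le Cam's method for mixtures\<close>

lemma PiM_density:
  fixes f :: "'a \<Rightarrow> ennreal"
  assumes "finite I" and M: "sigma_finite_measure M"
    and f [measurable]: "f \<in> borel_measurable M"
    and D: "sigma_finite_measure (density M f)"
  shows "Pi\<^sub>M I (\<lambda>_. density M f) = density (Pi\<^sub>M I (\<lambda>_. M)) (\<lambda>x. \<Prod>i\<in>I. f (x i))"
proof -
  interpret M: product_sigma_finite "\<lambda>_. M" using M by (simp add: product_sigma_finite_def)
  interpret D: product_sigma_finite "\<lambda>_. density M f" using D by (simp add: product_sigma_finite_def)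
  show ?thesis
  proof (rule D.PiM_eqI[symmetric])
    show "sets (density (Pi\<^sub>M I (\<lambda>_. M)) (\<lambda>x. \<Prod>i\<in>I. f (x i))) = sets (Pi\<^sub>M I (\<lambda>_. density M f))"
      by (simp cong: sets_PiM_cong)
    fix A assume A': "\<And>i. i \<in> I \<Longrightarrow> A i \<in> sets (density M f)"
    then have A [measurable]: "\<And>i. i \<in> I \<Longrightarrow> A i \<in> sets M" by simp
    have [measurable]: "Pi\<^sub>E I A \<in> sets (Pi\<^sub>M I (\<lambda>_. M))"
      using A \<open>finite I\<close> by (intro sets_PiM_I_finite) auto
    have "emeasure (density (Pi\<^sub>M I (\<lambda>_. M)) (\<lambda>x. \<Prod>i\<in>I. f (x i))) (Pi\<^sub>E I A)
        = (\<integral>\<^sup>+x. (\<Prod>i\<in>I. f (x i)) * indicator (Pi\<^sub>E I A) x \<partial>Pi\<^sub>M I (\<lambda>_. M))"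
      by (rule emeasure_density) measurable
    also have "\<dots> = (\<integral>\<^sup>+x. (\<Prod>i\<in>I. f (x i) * indicator (A i) (x i)) \<partial>Pi\<^sub>M I (\<lambda>_. M))"
    proof (rule nn_integral_cong)
      fix x assume "x \<in> space (Pi\<^sub>M I (\<lambda>_. M))"
      then have "x \<in> extensional I" by (auto simp: space_PiM PiE_def)
      then have "x \<in> Pi\<^sub>E I A \<longleftrightarrow> (\<forall>i\<in>I. x i \<in> A i)" by (auto simp: PiE_def)
      then show "(\<Prod>i\<in>I. f (x i)) * indicator (Pi\<^sub>E I A) x = (\<Prod>i\<in>I. f (x i) * indicator (A i) (x i))"
        using \<open>finite I\<close> by (auto simp: prod.distrib indicator_def intro!: prod_zero[symmetric])
    qed
    also have "\<dots> = (\<Prod>i\<in>I. \<integral>\<^sup>+x. f x * indicator (A i) x \<partial>M)"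
      using \<open>finite I\<close> A by (intro M.product_nn_integral_prod) auto
    also have "\<dots> = (\<Prod>i\<in>I. emeasure (density M f) (A i))"
      using A by (intro prod.cong refl emeasure_density[symmetric]) auto
    finally show "emeasure (density (Pi\<^sub>M I (\<lambda>_. M)) (\<lambda>x. \<Prod>i\<in>I. f (x i))) (Pi\<^sub>E I A)
        = (\<Prod>i\<in>I. emeasure (density M f) (A i))" .
  qed (use \<open>finite I\<close> in auto)
qed

text \<open>With \<open>L = q / p\<close>, the minimum \<open>min 1 L\<close> is at least \<open>L - L\<^sup>2 / 4\<close>, and no number \<open>s\<close> is close to
  both \<open>u\<close> and \<open>v\<close>: \<open>(v - u)\<^sup>2 / 2 \<le> (s - u)\<^sup>2 + (s - v)\<^sup>2\<close>. The bound is stated with \<open>q\<^sup>2 / p\<close>, whose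
  integral is one plus the chi-square divergence, because that integral factorises over
  independent samples.\<close>

lemma le_cam_pointwise:
  fixes p q s u v :: real
  assumes "0 < p" "0 \<le> q"
  shows "q * ((v - u)\<^sup>2 / 2) \<le> p * (s - u)\<^sup>2 + q * (s - v)\<^sup>2 + (v - u)\<^sup>2 / 8 * (q\<^sup>2 / p)"
proof -
  define L where "L = q / p"
  have q: "q = p * L" and L: "0 \<le> L" using assms by (auto simp: L_def)
  define m where "m = min 1 L"
  have "(v - u)\<^sup>2 / 2 \<le> (s - u)\<^sup>2 + (s - v)\<^sup>2"
    using zero_le_power2[of "2 * s - u - v"] by (simp add: power2_eq_square field_simps)
  moreover have m: "0 \<le> m" "m \<le> 1" "m \<le> L" using L by (auto simp: m_def)
  ultimately have "m * ((v - u)\<^sup>2 / 2) \<le> m * ((s - u)\<^sup>2 + (s - v)\<^sup>2)"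
    by (intro mult_left_mono) auto
  also have "\<dots> \<le> (s - u)\<^sup>2 + L * (s - v)\<^sup>2"
    using mult_right_mono[OF m(2), of "(s - u)\<^sup>2"] mult_right_mono[OF m(3), of "(s - v)\<^sup>2"]
    by (simp add: algebra_simps)
  finally have 1: "m * ((v - u)\<^sup>2 / 2) \<le> (s - u)\<^sup>2 + L * (s - v)\<^sup>2" .
  have "L - L\<^sup>2 / 4 \<le> m"
    using zero_le_power2[of "L - 2"] by (auto simp: m_def min_def power2_eq_square algebra_simps)
  then have "(L - L\<^sup>2 / 4) * ((v - u)\<^sup>2 / 2) \<le> m * ((v - u)\<^sup>2 / 2)"
    by (intro mult_right_mono) auto
  with 1 have "L * ((v - u)\<^sup>2 / 2) \<le> (s - u)\<^sup>2 + L * (s - v)\<^sup>2 + (v - u)\<^sup>2 / 8 * L\<^sup>2"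
    by (simp add: algebra_simps)
  then have "p * (L * ((v - u)\<^sup>2 / 2)) \<le> p * ((s - u)\<^sup>2 + L * (s - v)\<^sup>2 + (v - u)\<^sup>2 / 8 * L\<^sup>2)"
    using assms by (intro mult_left_mono) auto
  moreover have "q\<^sup>2 / p = p * L\<^sup>2" using assms by (simp add: L_def power2_eq_square)
  moreover have "q * t = p * (L * t)" for t by (simp add: q)
  ultimately show ?thesis by (simp only: distrib_left mult.left_commute)
qed

text \<open>Le Cam's method with a composite alternative. The law of the sample under the density \<open>k\<close> is
  compared with the uniform mixture of its laws under the densities \<open>h t\<close>. If the second moment of
  the likelihood ratio of the mixture is at most 2, the two cannot be told apart reliably, so an
  estimator of a functional with value \<open>u\<close> at \<open>k\<close> and \<open>v\<close> at every \<open>h t\<close> has a root mean square error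
  of at least a constant multiple of \<open>\<bar>v - u\<bar>\<close>. By independence that second moment is the average, over pairs \<open>s\<close>, \<open>t\<close>, of the
  \<open>n\<close>-th powers of one-sample integrals; this is the premise \<open>chi\<close>. Integrating
  \<open>le_cam_pointwise\<close> gives \<open>(v - u)\<^sup>2 / 2 \<le> 2 * R + (v - u)\<^sup>2 / 4\<close>.\<close>

lemma le_cam_mixture:
  fixes k :: "'a \<Rightarrow> real" and h :: "'t \<Rightarrow> 'a \<Rightarrow> real"
  assumes M: "prob_space M" and T: "finite T" "T \<noteq> {}"
    and [measurable]: "k \<in> borel_measurable M" "\<And>t. h t \<in> borel_measurable M"
    and pos: "\<And>x. x \<in> space M \<Longrightarrow> 0 < k x"
    and nn: "\<And>t x. x \<in> space M \<Longrightarrow> 0 \<le> h t x"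
    and int0: "(\<integral>\<^sup>+x. ennreal (k x) \<partial>M) = 1"
    and int: "\<And>t. t \<in> T \<Longrightarrow> (\<integral>\<^sup>+x. ennreal (h t x) \<partial>M) = 1"
    and chi: "(\<Sum>s\<in>T. \<Sum>t\<in>T. (\<integral>\<^sup>+x. ennreal (h s x * h t x / k x) \<partial>M) ^ n)
                \<le> 2 * ennreal ((real (card T))\<^sup>2)"
    and S [measurable]: "S \<in> borel_measurable (Pi\<^sub>M {..<n} (\<lambda>_. M))"
    and risk0: "(\<integral>\<^sup>+x. ennreal ((S x - u)\<^sup>2) \<partial>Pi\<^sub>M {..<n} (\<lambda>_. density M k)) \<le> R"
    and risk: "\<And>t. t \<in> T \<Longrightarrow>
                 (\<integral>\<^sup>+x. ennreal ((S x - v)\<^sup>2) \<partial>Pi\<^sub>M {..<n} (\<lambda>_. density M (h t))) \<le> R"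
  shows "ennreal ((v - u)\<^sup>2 / 8) \<le> R"
proof -
  interpret prob_space M by fact
  interpret P: product_sigma_finite "\<lambda>_. M" by standard
  define P where "P = Pi\<^sub>M {..<n} (\<lambda>_. M)"
  \<comment> \<open>The joint densities of the sample with respect to the product of \<open>M\<close>; \<open>q\<close> is the mixture.\<close>
  define p0 where "p0 x = (\<Prod>i<n. k (x i))" for x
  define p where "p t x = (\<Prod>i<n. h t (x i))" for t x
  define N where "N = real (card T)"
  have N: "0 < N" using T by (simp add: N_def card_gt_0_iff)
  define q where "q x = (\<Sum>t\<in>T. p t x) / N" for x
  have [measurable]: "S \<in> borel_measurable P" using S by (simp add: P_def)
  have [measurable]: "p0 \<in> borel_measurable P" "\<And>t. p t \<in> borel_measurable P"
    unfolding p0_def p_def P_def by measurable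
  have sp: "x i \<in> space M" if "x \<in> space P" "i < n" for x i
    using that by (auto simp: P_def space_PiM PiE_def)
  have p0_pos: "0 < p0 x" if "x \<in> space P" for x
    unfolding p0_def using sp[OF that] pos by (intro prod_pos) auto
  have p_nn: "0 \<le> p t x" if "x \<in> space P" for t x
    unfolding p_def using sp[OF that] nn by (intro prod_nonneg) auto
  have prodint: "(\<integral>\<^sup>+x. ennreal (\<Prod>i<n. g (x i)) \<partial>P) = (\<integral>\<^sup>+x. ennreal (g x) \<partial>M) ^ n"
    if [measurable]: "g \<in> borel_measurable M" and "\<And>x. x \<in> space M \<Longrightarrow> 0 \<le> g x" for g :: "'a \<Rightarrow> real"
  proof -
    have "(\<integral>\<^sup>+x. ennreal (\<Prod>i<n. g (x i)) \<partial>P) = (\<integral>\<^sup>+x. (\<Prod>i<n. ennreal (g (x i))) \<partial>P)"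
      using sp that(2) by (intro nn_integral_cong prod_ennreal[symmetric]) auto
    also have "\<dots> = (\<Prod>i<n. \<integral>\<^sup>+x. ennreal (g x) \<partial>M)"
      unfolding P_def by (intro P.product_nn_integral_prod) auto
    finally show ?thesis by simp
  qed
  have law: "(\<integral>\<^sup>+x. ennreal (f x) \<partial>Pi\<^sub>M {..<n} (\<lambda>_. density M (\<lambda>x. ennreal (g x))))
      = (\<integral>\<^sup>+x. ennreal ((\<Prod>i<n. g (x i)) * f x) \<partial>P)"
    if [measurable]: "g \<in> borel_measurable M" "f \<in> borel_measurable P"
      and g: "\<And>x. x \<in> space M \<Longrightarrow> 0 \<le> g x" "(\<integral>\<^sup>+x. ennreal (g x) \<partial>M) = 1"
      and f: "\<And>x. 0 \<le> f x" for f g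
  proof -
    interpret g: prob_space "density M g"
      using g by (intro prob_spaceI) (simp add: emeasure_density cong: nn_integral_cong_simp)
    have "Pi\<^sub>M {..<n} (\<lambda>_. density M g) = density P (\<lambda>x. \<Prod>i<n. ennreal (g (x i)))"
      unfolding P_def by (rule PiM_density) (auto intro: sigma_finite_measure_axioms g.sigma_finite_measure_axioms)
    moreover have "(\<lambda>x. \<Prod>i<n. ennreal (g (x i))) \<in> borel_measurable P"
      unfolding P_def by measurable
    ultimately have "(\<integral>\<^sup>+x. ennreal (f x) \<partial>Pi\<^sub>M {..<n} (\<lambda>_. density M g))
       = (\<integral>\<^sup>+x. (\<Prod>i<n. ennreal (g (x i))) * ennreal (f x) \<partial>P)"
      by (simp add: nn_integral_density)
    also have "\<dots> = (\<integral>\<^sup>+x. ennreal ((\<Prod>i<n. g (x i)) * f x) \<partial>P)"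
    proof (rule nn_integral_cong)
      fix x assume x: "x \<in> space P"
      have "(\<Prod>i<n. ennreal (g (x i))) = ennreal (\<Prod>i<n. g (x i))"
        using sp[OF x] g(1) by (intro prod_ennreal) auto
      then show "(\<Prod>i<n. ennreal (g (x i))) * ennreal (f x) = ennreal ((\<Prod>i<n. g (x i)) * f x)"
        using f[of x] by (simp add: ennreal_mult'')
    qed
    finally show ?thesis .
  qed
  have r0: "(\<integral>\<^sup>+x. ennreal (p0 x * (S x - u)\<^sup>2) \<partial>P) \<le> R"
    using risk0 law[of k "\<lambda>x. (S x - u)\<^sup>2"] pos int0 by (simp add: p0_def less_imp_le)
  have avg: "(\<integral>\<^sup>+x. ennreal ((\<Sum>t\<in>T. f t x) / N) \<partial>P) = (\<Sum>t\<in>T. \<integral>\<^sup>+x. ennreal (f t x) \<partial>P) / ennreal N"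
    if [measurable]: "\<And>t. f t \<in> borel_measurable P" and f: "\<And>t x. x \<in> space P \<Longrightarrow> 0 \<le> f t x" for f
  proof -
    have "(\<integral>\<^sup>+x. ennreal ((\<Sum>t\<in>T. f t x) / N) \<partial>P) = (\<integral>\<^sup>+x. (\<Sum>t\<in>T. ennreal (f t x)) / ennreal N \<partial>P)"
      using f N by (intro nn_integral_cong) (simp add: divide_ennreal[symmetric] sum_nonneg)
    also have "\<dots> = (\<Sum>t\<in>T. \<integral>\<^sup>+x. ennreal (f t x) \<partial>P) / ennreal N"
      by (simp add: nn_integral_divide nn_integral_sum)
    finally show ?thesis .
  qed
  have avg_le: "(\<Sum>t\<in>T. g t) / ennreal N \<le> c" if "\<And>t. t \<in> T \<Longrightarrow> g t \<le> c" for g c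
  proof -
    have "(\<Sum>t\<in>T. g t) / ennreal N \<le> (\<Sum>t\<in>T. c) / ennreal N"
      using that by (intro divide_right_mono_ennreal sum_mono) auto
    also have "\<dots> = c" using N
      by (simp add: N_def ennreal_of_nat_eq_real_of_nat mult.commute ennreal_mult_divide_eq)
    finally show ?thesis .
  qed
  have r1: "(\<integral>\<^sup>+x. ennreal (q x * (S x - v)\<^sup>2) \<partial>P) \<le> R"
  proof -
    have "(\<integral>\<^sup>+x. ennreal (q x * (S x - v)\<^sup>2) \<partial>P) = (\<integral>\<^sup>+x. ennreal ((\<Sum>t\<in>T. p t x * (S x - v)\<^sup>2) / N) \<partial>P)"
      by (simp add: q_def sum_distrib_right)
    also have "\<dots> = (\<Sum>t\<in>T. \<integral>\<^sup>+x. ennreal (p t x * (S x - v)\<^sup>2) \<partial>P) / ennreal N"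
      using p_nn by (intro avg) auto
    also have "\<dots> \<le> R"
    proof (rule avg_le)
      fix t assume "t \<in> T"
      then show "(\<integral>\<^sup>+x. ennreal (p t x * (S x - v)\<^sup>2) \<partial>P) \<le> R"
        using risk[of t] law[of "h t" "\<lambda>x. (S x - v)\<^sup>2"] nn int[of t] by (simp add: p_def)
    qed
    finally show ?thesis .
  qed
  have q_int: "(\<integral>\<^sup>+x. ennreal (q x) \<partial>P) = 1"
  proof -
    have "(\<integral>\<^sup>+x. ennreal (q x) \<partial>P) = (\<Sum>t\<in>T. \<integral>\<^sup>+x. ennreal (p t x) \<partial>P) / ennreal N"
      unfolding q_def using p_nn by (intro avg) auto
    also have "(\<Sum>t\<in>T. \<integral>\<^sup>+x. ennreal (p t x) \<partial>P) = (\<Sum>t\<in>T. 1)"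
      unfolding p_def using prodint[of "h _"] nn int by (intro sum.cong) auto
    finally show ?thesis using N by (simp add: N_def ennreal_of_nat_eq_real_of_nat divide_ennreal)
  qed
  have q_chi: "(\<integral>\<^sup>+x. ennreal ((q x)\<^sup>2 / p0 x) \<partial>P) \<le> 2"
  proof -
    have "(\<integral>\<^sup>+x. ennreal ((q x)\<^sup>2 / p0 x) \<partial>P)
        = (\<integral>\<^sup>+x. ennreal ((\<Sum>s\<in>T. (\<Sum>t\<in>T. p s x * p t x / p0 x) / N) / N) \<partial>P)"
      by (intro nn_integral_cong arg_cong[of _ _ ennreal])
         (simp add: q_def power2_eq_square sum_product sum_divide_distrib mult_ac)
    also have "\<dots> = (\<Sum>s\<in>T. \<integral>\<^sup>+x. ennreal ((\<Sum>t\<in>T. p s x * p t x / p0 x) / N) \<partial>P) / ennreal N"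
      using p_nn p0_pos N by (intro avg) (auto intro!: sum_nonneg divide_nonneg_nonneg simp: less_imp_le)
    also have "\<dots> = (\<Sum>s\<in>T. (\<Sum>t\<in>T. \<integral>\<^sup>+x. ennreal (p s x * p t x / p0 x) \<partial>P) / ennreal N) / ennreal N"
      using p_nn p0_pos by (subst avg) (auto intro!: divide_nonneg_nonneg simp: less_imp_le)
    also have "\<dots> = (\<Sum>s\<in>T. (\<Sum>t\<in>T. (\<integral>\<^sup>+x. ennreal (h s x * h t x / k x) \<partial>M) ^ n) / ennreal N) / ennreal N"
    proof -
      have "(\<integral>\<^sup>+x. ennreal (p s x * p t x / p0 x) \<partial>P) = (\<integral>\<^sup>+x. ennreal (h s x * h t x / k x) \<partial>M) ^ n" for s t
        using prodint[of "\<lambda>x. h s x * h t x / k x"] nn pos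
        by (simp add: p_def p0_def prod.distrib prod_dividef less_imp_le)
      then show ?thesis by simp
    qed
    also have "\<dots> = (\<Sum>s\<in>T. \<Sum>t\<in>T. (\<integral>\<^sup>+x. ennreal (h s x * h t x / k x) \<partial>M) ^ n) / ennreal N / ennreal N"
      by (simp add: divide_ennreal_def sum_distrib_right)
    also have "\<dots> \<le> (2 * ennreal (N\<^sup>2)) / ennreal N / ennreal N"
      using chi by (intro divide_right_mono_ennreal) (simp add: N_def)
    also have "2 * ennreal (N\<^sup>2) = ennreal (2 * N\<^sup>2)" by (simp add: ennreal_mult'')
    also have "ennreal (2 * N\<^sup>2) / ennreal N / ennreal N = ennreal 2"
      using N by (simp add: divide_ennreal power2_eq_square del: ennreal_numeral)
    finally show ?thesis by simp
  qed
  define d where "d = (v - u)\<^sup>2"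
  have d: "0 \<le> d" by (simp add: d_def)
  have [measurable]: "q \<in> borel_measurable P" unfolding q_def by measurable
  have q_nn: "0 \<le> q x" if "x \<in> space P" for x
    unfolding q_def using p_nn[OF that] N by (simp add: sum_nonneg)
  have "(\<integral>\<^sup>+x. ennreal (q x * (d / 2)) \<partial>P)
    \<le> (\<integral>\<^sup>+x. ennreal (p0 x * (S x - u)\<^sup>2) + ennreal (q x * (S x - v)\<^sup>2)
            + ennreal (d / 8 * ((q x)\<^sup>2 / p0 x)) \<partial>P)"
  proof (rule nn_integral_mono)
    fix x assume x: "x \<in> space P"
    note nn = p0_pos[OF x] q_nn[OF x] d
    show "ennreal (q x * (d / 2)) \<le> ennreal (p0 x * (S x - u)\<^sup>2) + ennreal (q x * (S x - v)\<^sup>2)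
            + ennreal (d / 8 * ((q x)\<^sup>2 / p0 x))"
      using le_cam_pointwise[OF nn(1,2), of v u "S x"] nn
      by (simp add: d_def ennreal_plus[symmetric] del: ennreal_plus)
  qed
  also have "\<dots> = (\<integral>\<^sup>+x. ennreal (p0 x * (S x - u)\<^sup>2) \<partial>P) + (\<integral>\<^sup>+x. ennreal (q x * (S x - v)\<^sup>2) \<partial>P)
      + (\<integral>\<^sup>+x. ennreal (d / 8 * ((q x)\<^sup>2 / p0 x)) \<partial>P)"
    by (simp add: nn_integral_add)
  also have "(\<integral>\<^sup>+x. ennreal (d / 8 * ((q x)\<^sup>2 / p0 x)) \<partial>P) = ennreal (d / 8) * (\<integral>\<^sup>+x. ennreal ((q x)\<^sup>2 / p0 x) \<partial>P)"
    using d by (subst nn_integral_cmult[symmetric]) (auto simp: ennreal_mult'[symmetric])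
  also have "(\<integral>\<^sup>+x. ennreal (q x * (d / 2)) \<partial>P) = (\<integral>\<^sup>+x. ennreal (q x) \<partial>P) * ennreal (d / 2)"
    using d by (subst nn_integral_multc[symmetric]) (auto simp: ennreal_mult''[symmetric])
  finally have "ennreal (d / 2) \<le> R + R + ennreal (d / 8) * 2"
    using r0 r1 mult_left_mono[OF q_chi, of "ennreal (d / 8)"] q_int
    by (auto elim!: order_trans intro!: add_mono)
  then show ?thesis
    using d
    by (cases R) (auto simp: d_def[symmetric] ennreal_mult''[symmetric] ennreal_plus[symmetric]
        ennreal_numeral[symmetric] top_unique simp del: ennreal_plus ennreal_numeral)
qed

section \<open>Perturbations of the constant density\<close>

lemma borel_measurable_cnj [measurable]: "cnj \<in> borel_measurable borel"
  by (intro borel_measurable_continuous_onI continuous_intros)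

text \<open>An orthonormal system of functions bounded by \<open>C\<close>, closed under complex conjugation through the
  permutation \<open>\<sigma>\<close> of the indices, in which \<open>e\<close> is the index of the constant function. Finite
  combinations with real, \<open>\<sigma>\<close>-invariant coefficients are then real functions.\<close>

locale conj_basis = prob_space M for M :: "'a measure" +
  fixes \<psi> :: "'i \<Rightarrow> 'a \<Rightarrow> complex" and C :: real and \<sigma> :: "'i \<Rightarrow> 'i" and e :: 'i
  assumes psi_measurable [measurable]: "\<psi> z \<in> borel_measurable M"
    and orthonormal: "coeff M \<psi> (\<psi> w) z = (if z = w then 1 else 0)"
    and bounded: "AE x in M. cmod (\<psi> z x) \<le> C"
    and conj: "AE x in M. cnj (\<psi> z x) = \<psi> (\<sigma> z) x"
    and one: "AE x in M. \<psi> e x = 1"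
begin

lemma bound_ge_1: "1 \<le> C"
proof -
  have "AE x in M. 1 \<le> C" using bounded[of e] one by eventually_elim simp
  then show ?thesis by simp
qed

lemma psi_inj:
  assumes "AE x in M. \<psi> z x = \<psi> w x"
  shows "z = w"
proof -
  have "coeff M \<psi> (\<psi> z) w = coeff M \<psi> (\<psi> w) w"
    unfolding coeff_def using assms by (intro integral_cong_AE) auto
  then show ?thesis by (auto simp: orthonormal split: if_splits)
qed

lemma sigma_invol [simp]: "\<sigma> (\<sigma> z) = z"
proof (rule psi_inj)
  show "AE x in M. \<psi> (\<sigma> (\<sigma> z)) x = \<psi> z x"
    using conj[of "\<sigma> z"] conj[of z] by eventually_elim (metis complex_cnj_cnj)
qed

lemma sigma_e [simp]: "\<sigma> e = e"
proof (rule psi_inj)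
  show "AE x in M. \<psi> (\<sigma> e) x = \<psi> e x"
    using conj[of e] one by eventually_elim (metis complex_cnj_one)
qed

lemma integrable_psi_mult:
  assumes [measurable]: "f \<in> borel_measurable M" and "AE x in M. cmod (f x) \<le> K"
  shows "integrable M (\<lambda>x. f x * cnj (\<psi> z x))"
proof (rule integrable_const_bound)
  show "AE x in M. cmod (f x * cnj (\<psi> z x)) \<le> K * C"
    using assms(2) bounded[of z]
    by eventually_elim (auto simp: norm_mult intro: mult_mono order_trans[OF norm_ge_zero])
qed simp

text \<open>Coefficient families for which the combination is almost everywhere real and at least \<open>1 / 2\<close>,
  and has integral 1: symmetry under \<open>\<sigma>\<close> gives the first, smallness of the coefficients other than
  the one at \<open>e\<close> the second, and the normalisation at \<open>e\<close> the third.\<close>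

definition admissible :: "'i set \<Rightarrow> ('i \<Rightarrow> real) \<Rightarrow> bool" where
  "admissible F c \<longleftrightarrow> finite F \<and> e \<in> F \<and> \<sigma> ` F \<subseteq> F \<and> c e = 1 \<and> (\<forall>w\<in>F. c (\<sigma> w) = c w)
     \<and> C * (\<Sum>w\<in>F - {e}. \<bar>c w\<bar>) \<le> 1 / 2"

text \<open>The truncation at \<open>1 / 2\<close> changes nothing outside a null set when the coefficients are
  admissible. It makes the density positive at every point, so that it can be divided by, and so that it is
  nonnegative in the pointwise sense of \<open>density_ball\<close>.\<close>

definition perturbed :: "'i set \<Rightarrow> ('i \<Rightarrow> real) \<Rightarrow> 'a \<Rightarrow> real" where
  "perturbed F c x = max (1 / 2) (Re (\<Sum>w\<in>F. of_real (c w) * \<psi> w x))"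

lemma perturbed_measurable [measurable]: "perturbed F c \<in> borel_measurable M"
  unfolding perturbed_def by measurable

lemma perturbed_ge: "1 / 2 \<le> perturbed F c x"
  by (simp add: perturbed_def)

lemma sum_bound_AE:
  assumes "finite G"
  shows "AE x in M. cmod (\<Sum>w\<in>G. of_real (c w) * \<psi> w x) \<le> C * (\<Sum>w\<in>G. \<bar>c w\<bar>)"
proof -
  have "AE x in M. \<forall>w\<in>G. cmod (\<psi> w x) \<le> C"
    using assms bounded by (simp add: AE_ball_countable countable_finite)
  then show ?thesis
  proof eventually_elim
    case (elim x)
    have "cmod (\<Sum>w\<in>G. of_real (c w) * \<psi> w x) \<le> (\<Sum>w\<in>G. \<bar>c w\<bar> * C)"
      using elim by (intro sum_norm_le) (auto simp: norm_mult intro: mult_left_mono)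
    then show ?case by (simp add: sum_distrib_left mult.commute)
  qed
qed

lemma perturbed_eq_AE:
  assumes "admissible F c"
  shows "AE x in M. complex_of_real (perturbed F c x) = (\<Sum>w\<in>F. of_real (c w) * \<psi> w x)"
proof -
  have F: "finite F" "e \<in> F" "\<sigma> ` F \<subseteq> F" and c: "c e = 1" "\<forall>w\<in>F. c (\<sigma> w) = c w"
    and le: "C * (\<Sum>w\<in>F - {e}. \<bar>c w\<bar>) \<le> 1 / 2"
    using assms by (auto simp: admissible_def)
  have "AE x in M. \<forall>w\<in>F. cnj (\<psi> w x) = \<psi> (\<sigma> w) x"
    using F conj by (simp add: AE_ball_countable countable_finite)
  moreover have "AE x in M. cmod (\<Sum>w\<in>F - {e}. of_real (c w) * \<psi> w x) \<le> C * (\<Sum>w\<in>F - {e}. \<bar>c w\<bar>)"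
    using F by (intro sum_bound_AE) auto
  ultimately show ?thesis using one
  proof eventually_elim
    case (elim x)
    define s where "s = (\<Sum>w\<in>F. of_real (c w) * \<psi> w x)"
    have bij: "bij_betw \<sigma> F F"
      using F(3) by (intro bij_betw_byWitness[of _ \<sigma>]) auto
    have "cnj s = (\<Sum>w\<in>F. of_real (c (\<sigma> w)) * \<psi> (\<sigma> w) x)"
      unfolding s_def using elim(1) c by (simp cong: sum.cong)
    also have "\<dots> = s" unfolding s_def by (rule sum.reindex_bij_betw[OF bij])
    finally have "Im s = 0" by (simp add: complex_eq_iff)
    then have real: "s = of_real (Re s)" by (simp add: complex_eq_iff)
    have s: "s = 1 + (\<Sum>w\<in>F - {e}. of_real (c w) * \<psi> w x)"
      unfolding s_def using F c elim(3) by (subst sum.remove[of _ e]) auto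
    have "\<bar>Re (s - 1)\<bar> \<le> cmod (s - 1)" by (rule abs_Re_le_cmod)
    moreover have "cmod (s - 1) \<le> 1 / 2" using elim(2) le by (simp add: s)
    ultimately have "1 / 2 \<le> Re s" unfolding minus_complex.sel one_complex.sel by linarith
    then have "perturbed F c x = Re s" by (simp add: perturbed_def s_def)
    with real show ?case by (simp add: s_def[symmetric])
  qed
qed

lemma perturbed_bounded_AE:
  assumes "admissible F c"
  shows "AE x in M. \<bar>perturbed F c x\<bar> \<le> C * (\<Sum>w\<in>F. \<bar>c w\<bar>)"
proof -
  have "finite F" using assms by (simp add: admissible_def)
  from sum_bound_AE[OF this, of c] perturbed_eq_AE[OF assms] show ?thesis
    by eventually_elim (metis norm_of_real)
qed

lemma coeff_perturbed:
  assumes "admissible F c"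
  shows "coeff M \<psi> (\<lambda>x. complex_of_real (perturbed F c x)) z = (if z \<in> F then of_real (c z) else 0)"
proof -
  have F: "finite F" using assms by (simp add: admissible_def)
  have "coeff M \<psi> (\<lambda>x. complex_of_real (perturbed F c x)) z
      = (LINT x|M. (\<Sum>w\<in>F. of_real (c w) * \<psi> w x) * cnj (\<psi> z x))"
    unfolding coeff_def using perturbed_eq_AE[OF assms] by (intro integral_cong_AE) auto
  also have "\<dots> = (LINT x|M. (\<Sum>w\<in>F. of_real (c w) * (\<psi> w x * cnj (\<psi> z x))))"
    by (simp add: sum_distrib_right mult.assoc)
  also have "\<dots> = (\<Sum>w\<in>F. of_real (c w) * coeff M \<psi> (\<psi> w) z)"
    unfolding coeff_def using integrable_psi_mult[OF psi_measurable bounded]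
    by (subst Bochner_Integration.integral_sum) auto
  also have "\<dots> = (\<Sum>w\<in>F. if w = z then of_real (c z) else 0)"
    by (intro sum.cong) (auto simp: orthonormal)
  finally show ?thesis using F by simp
qed

lemma perturbed_product_integrable:
  assumes "admissible F c" "admissible F c'"
  shows "integrable M (\<lambda>x. perturbed F c x * perturbed F c' x)"
proof (rule integrable_const_bound)
  show "AE x in M. norm (perturbed F c x * perturbed F c' x) \<le> (C * (\<Sum>w\<in>F. \<bar>c w\<bar>)) * (C * (\<Sum>w\<in>F. \<bar>c' w\<bar>))"
    using perturbed_bounded_AE[OF assms(1)] perturbed_bounded_AE[OF assms(2)]
    by eventually_elim (auto simp: abs_mult intro: mult_mono order_trans[OF abs_ge_zero])
qed simp

lemma integral_perturbed_product:
  assumes "admissible F c" "admissible F c'"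
  shows "(LINT x|M. perturbed F c x * perturbed F c' x) = (\<Sum>w\<in>F. c w * c' w)"
proof -
  let ?h = "\<lambda>x. complex_of_real (perturbed F c x)"
  have F: "finite F" using assms by (simp add: admissible_def)
  have b: "AE x in M. cmod (?h x) \<le> C * (\<Sum>w\<in>F. \<bar>c w\<bar>)"
    using perturbed_bounded_AE[OF assms(1)] by simp
  have "complex_of_real (LINT x|M. perturbed F c x * perturbed F c' x)
      = (LINT x|M. ?h x * complex_of_real (perturbed F c' x))"
    by (simp flip: integral_complex_of_real)
  also have "\<dots> = (LINT x|M. (\<Sum>w\<in>F. of_real (c' w) * (?h x * cnj (\<psi> w x))))"
  proof (rule integral_cong_AE)
    show "AE x in M. ?h x * complex_of_real (perturbed F c' x) = (\<Sum>w\<in>F. of_real (c' w) * (?h x * cnj (\<psi> w x)))"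
      using perturbed_eq_AE[OF assms(2)]
    proof eventually_elim
      case (elim x)
      have "complex_of_real (perturbed F c' x) = cnj (complex_of_real (perturbed F c' x))" by simp
      also have "\<dots> = (\<Sum>w\<in>F. of_real (c' w) * cnj (\<psi> w x))" unfolding elim by simp
      finally show ?case by (simp add: sum_distrib_left mult.left_commute)
    qed
  qed auto
  also have "\<dots> = (\<Sum>w\<in>F. of_real (c' w) * coeff M \<psi> ?h w)"
    unfolding coeff_def using integrable_psi_mult[OF _ b]
    by (subst Bochner_Integration.integral_sum) auto
  also have "\<dots> = complex_of_real (\<Sum>w\<in>F. c w * c' w)"
    by (simp add: coeff_perturbed[OF assms(1)] mult.commute)
  finally show ?thesis by (simp only: of_real_eq_iff)
qed

lemma perturbed_integrable: "admissible F c \<Longrightarrow> integrable M (perturbed F c)"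
  using perturbed_bounded_AE by (intro integrable_const_bound) auto

lemma integral_perturbed:
  assumes "admissible F c"
  shows "(LINT x|M. perturbed F c x) = 1"
proof -
  have "complex_of_real (LINT x|M. perturbed F c x) = (LINT x|M. complex_of_real (perturbed F c x) * cnj (\<psi> e x))"
    unfolding integral_complex_of_real[symmetric]
  proof (rule integral_cong_AE)
    show "AE x in M. complex_of_real (perturbed F c x) = complex_of_real (perturbed F c x) * cnj (\<psi> e x)"
      using one by eventually_elim simp
  qed auto
  also have "\<dots> = 1"
    using coeff_perturbed[OF assms, of e] assms by (simp add: coeff_def admissible_def)
  finally show ?thesis by simp
qed

lemma nn_integral_perturbed:
  assumes "admissible F c"
  shows "(\<integral>\<^sup>+x. ennreal (perturbed F c x) \<partial>M) = 1"
proof -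
  have "0 \<le> perturbed F c x" for x using perturbed_ge[of F c x] by linarith
  then show ?thesis
    using perturbed_integrable[OF assms] integral_perturbed[OF assms]
    by (simp add: nn_integral_eq_integral)
qed

lemma wnorm2_perturbed:
  assumes "admissible F c"
  shows "wnorm2 M \<psi> a (\<lambda>x. complex_of_real (perturbed F c x)) = ennreal (\<Sum>w\<in>F. (c w)\<^sup>2 / (a w)\<^sup>2)"
proof -
  have F: "finite F" using assms by (simp add: admissible_def)
  have "wnorm2 M \<psi> a (\<lambda>x. complex_of_real (perturbed F c x)) = (\<Sum>\<^sub>\<infinity>z\<in>F. ennreal ((c z)\<^sup>2 / (a z)\<^sup>2))"
    unfolding wnorm2_def coeff_perturbed[OF assms] by (intro infsum_cong_neutral) auto
  with F show ?thesis by simp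
qed

lemma perturbed_in_ball:
  assumes "admissible F c" "(\<Sum>w\<in>F. (c w)\<^sup>2 / (b w)\<^sup>2) \<le> 1"
  shows "perturbed F c \<in> density_ball M \<psi> b"
proof -
  have "0 \<le> perturbed F c x" for x using perturbed_ge[of F c x] by linarith
  moreover have "integrable M (\<lambda>x. (perturbed F c x)\<^sup>2)"
    using perturbed_product_integrable[OF assms(1,1)] by (simp add: power2_eq_square)
  ultimately show ?thesis
    using assms nn_integral_perturbed[OF assms(1)]
    by (simp add: density_ball_def L2_def wnorm2_perturbed)
qed

text \<open>Le Cam's method within the class of perturbed densities, where both the ball and the
  functional are explicit in the coefficients.\<close>

lemma minimax_risk_ge_mixture:
  assumes T: "finite T" "T \<noteq> {}"
    and adm: "admissible F k" "\<And>t. t \<in> T \<Longrightarrow> admissible F (c t)"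
    and ball: "(\<Sum>w\<in>F. (k w)\<^sup>2 / (b w)\<^sup>2) \<le> 1" "\<And>t. t \<in> T \<Longrightarrow> (\<Sum>w\<in>F. (c t w)\<^sup>2 / (b w)\<^sup>2) \<le> 1"
    and u: "(\<Sum>w\<in>F. (k w)\<^sup>2 / (a w)\<^sup>2) = u"
    and v: "\<And>t. t \<in> T \<Longrightarrow> (\<Sum>w\<in>F. (c t w)\<^sup>2 / (a w)\<^sup>2) = v"
    and chi: "(\<Sum>s\<in>T. \<Sum>t\<in>T.
        (\<integral>\<^sup>+x. ennreal (perturbed F (c s) x * perturbed F (c t) x / perturbed F k x) \<partial>M) ^ n)
          \<le> 2 * ennreal ((real (card T))\<^sup>2)"
  shows "ennreal ((v - u)\<^sup>2 / 8) \<le> minimax_risk M \<psi> a b n"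
  unfolding minimax_risk_def
proof (rule INF_greatest)
  fix S :: "(nat \<Rightarrow> 'a) \<Rightarrow> real"
  let ?risk = "\<lambda>h. \<integral>\<^sup>+x. ennreal ((S x - enn2real (wnorm2 M \<psi> a (\<lambda>y. complex_of_real (h y))))\<^sup>2)
          \<partial>(Pi\<^sub>M {..<n} (\<lambda>_. density M (\<lambda>y. ennreal (h y))))"
  assume S: "S \<in> borel_measurable (Pi\<^sub>M {..<n} (\<lambda>_. M))"
  have pos: "0 < perturbed F d x" for d x using perturbed_ge[of F d x] by linarith
  have val: "enn2real (wnorm2 M \<psi> a (\<lambda>y. complex_of_real (perturbed F d y))) = (\<Sum>w\<in>F. (d w)\<^sup>2 / (a w)\<^sup>2)"
    if "admissible F d" for d using that by (simp add: wnorm2_perturbed sum_nonneg)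
  show "ennreal ((v - u)\<^sup>2 / 8) \<le> (SUP h \<in> density_ball M \<psi> b. ?risk h)"
  proof (rule le_cam_mixture[where k = "perturbed F k" and h = "\<lambda>t. perturbed F (c t)" and T = T])
    have "?risk (perturbed F k) \<le> (SUP h \<in> density_ball M \<psi> b. ?risk h)"
      using perturbed_in_ball[OF adm(1) ball(1)] by (rule SUP_upper)
    then show "(\<integral>\<^sup>+x. ennreal ((S x - u)\<^sup>2) \<partial>Pi\<^sub>M {..<n} (\<lambda>_. density M (perturbed F k)))
        \<le> (SUP h \<in> density_ball M \<psi> b. ?risk h)"
      by (simp add: val adm u)
    fix t assume t: "t \<in> T"
    have "?risk (perturbed F (c t)) \<le> (SUP h \<in> density_ball M \<psi> b. ?risk h)"
      using perturbed_in_ball[OF adm(2)[OF t] ball(2)[OF t]] by (rule SUP_upper)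
    then show "(\<integral>\<^sup>+x. ennreal ((S x - v)\<^sup>2) \<partial>Pi\<^sub>M {..<n} (\<lambda>_. density M (perturbed F (c t))))
        \<le> (SUP h \<in> density_ball M \<psi> b. ?risk h)"
      by (simp add: val adm(2)[OF t] v[OF t])
  qed (use T chi S pos less_imp_le adm nn_integral_perturbed in \<open>auto intro: prob_space_axioms\<close>)
qed

end

section \<open>Lower bounds at a fixed sample size\<close>

text \<open>The terms of first order in \<open>exp x\<close> and \<open>exp (- x)\<close> cancel: the exponential moment of a random
  sign exceeds 1 only to second order. This is where random signs gain over a fixed perturbation.\<close>

lemma exp_sum_le_exp_square:
  fixes x :: real
  assumes "\<bar>x\<bar> \<le> 1"
  shows "exp x + exp (- x) \<le> 2 * exp (x\<^sup>2)"
proof -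
  have *: "exp y + exp (- y) \<le> 2 * exp (y\<^sup>2)" if y: "0 \<le> y" "y \<le> 1" for y :: real
  proof -
    have "1 + y \<le> exp y" by simp
    have "1 \<le> (1 + y) * (1 - y + y\<^sup>2)" using y by (simp add: algebra_simps power2_eq_square)
    also have "\<dots> \<le> exp y * (1 - y + y\<^sup>2)"
      using y by (intro mult_right_mono) auto
    finally have "exp (- y) \<le> 1 - y + y\<^sup>2" by (simp add: exp_minus field_simps)
    moreover have "exp y \<le> 1 + y + y\<^sup>2" using y by (rule exp_bound)
    moreover have "1 + y\<^sup>2 \<le> exp (y\<^sup>2)" by simp
    ultimately show ?thesis by linarith
  qed
  show ?thesis using *[of x] *[of "- x"] assms by (cases "0 \<le> x") (auto simp: add.commute)
qed

lemma exp_half_le_2: "x \<le> 1 / 2 \<Longrightarrow> exp x \<le> (2::real)"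
  using exp_bound_half[of "1 / 2 :: real"] order_trans[of "exp x" "exp (1 / 2)" 2] by simp

text \<open>Signs attached to the classes of a partition of \<open>Z\<close> into blocks of at most two elements: for
  independent random signs \<open>t\<close> the exponential moment factorises over the classes, and every class
  contributes at most \<open>exp (4 * l\<^sup>2)\<close>. So the average is at most 2 as soon as \<open>l\<^sup>2\<close> is of order
  \<open>1 / card Z\<close>; a bound without cancellation would need \<open>l\<close> of that order.\<close>

lemma sum_exp_signs_le:
  fixes \<rho> :: "'i \<Rightarrow> 'i" and l :: real
  assumes Z: "finite Z" and fibre: "\<And>r. r \<in> \<rho> ` Z \<Longrightarrow> card {w \<in> Z. \<rho> w = r} \<le> 2"
    and s: "s \<in> Pi\<^sub>E (\<rho> ` Z) (\<lambda>_. {1, - 1})"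
    and l: "8 * l\<^sup>2 * real (card Z) \<le> 1"
  shows "(\<Sum>t\<in>Pi\<^sub>E (\<rho> ` Z) (\<lambda>_. {1, - 1}). exp (l * (\<Sum>w\<in>Z. s (\<rho> w) * t (\<rho> w)))) \<le> 2 * 2 ^ card (\<rho> ` Z)"
proof -
  define m where "m r = real (card {w \<in> Z. \<rho> w = r})" for r
  have fin: "finite (\<rho> ` Z)" using Z by simp
  have grp: "(\<Sum>w\<in>Z. s (\<rho> w) * t (\<rho> w)) = (\<Sum>r\<in>\<rho> ` Z. m r * (s r * t r))" for t
  proof -
    have "(\<Sum>w\<in>Z. s (\<rho> w) * t (\<rho> w)) = (\<Sum>r\<in>\<rho> ` Z. \<Sum>w\<in>{w \<in> Z. \<rho> w = r}. s (\<rho> w) * t (\<rho> w))"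
      using Z by (rule sum.image_gen)
    also have "\<dots> = (\<Sum>r\<in>\<rho> ` Z. m r * (s r * t r))" by (intro sum.cong) (auto simp: m_def)
    finally show ?thesis .
  qed
  have "(\<Sum>t\<in>Pi\<^sub>E (\<rho> ` Z) (\<lambda>_. {1, - 1}). exp (l * (\<Sum>w\<in>Z. s (\<rho> w) * t (\<rho> w))))
      = (\<Sum>t\<in>Pi\<^sub>E (\<rho> ` Z) (\<lambda>_. {1, - 1}). \<Prod>r\<in>\<rho> ` Z. exp (l * m r * s r * t r))"
    using fin by (simp add: grp exp_sum sum_distrib_left mult.assoc)
  also have "\<dots> = (\<Prod>r\<in>\<rho> ` Z. \<Sum>\<epsilon>\<in>{1, - 1}. exp (l * m r * s r * \<epsilon>))"
    using fin by (intro prod_sum_PiE[symmetric]) auto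
  also have "\<dots> \<le> (\<Prod>r\<in>\<rho> ` Z. 2 * exp (4 * l\<^sup>2))"
  proof (intro prod_mono conjI)
    fix r assume r: "r \<in> \<rho> ` Z"
    then have "1 \<le> real (card Z)" using Z by (cases "card Z") auto
    then have "8 * l\<^sup>2 * 1 \<le> 8 * l\<^sup>2 * real (card Z)" by (intro mult_left_mono) auto
    with l have l8: "8 * l\<^sup>2 \<le> 1" by linarith
    have "s r \<in> {1, - 1}" using s r by (auto simp: PiE_def)
    then have "(s r)\<^sup>2 = 1" by auto
    then have sq: "(l * m r * s r)\<^sup>2 = l\<^sup>2 * (m r)\<^sup>2" by (simp add: power_mult_distrib)
    have "m r \<le> 2" using fibre[OF r] by (simp add: m_def)
    then have "(m r)\<^sup>2 \<le> 2\<^sup>2" by (intro power_mono) (auto simp: m_def)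
    then have "l\<^sup>2 * (m r)\<^sup>2 \<le> l\<^sup>2 * 4" by (intro mult_left_mono) auto
    with sq have x: "(l * m r * s r)\<^sup>2 \<le> 4 * l\<^sup>2" by simp
    with l8 have "(l * m r * s r)\<^sup>2 \<le> 1" by linarith
    then have "\<bar>l * m r * s r\<bar> \<le> 1" by (simp add: abs_square_le_1)
    then have "exp (l * m r * s r) + exp (- (l * m r * s r)) \<le> 2 * exp ((l * m r * s r)\<^sup>2)"
      by (rule exp_sum_le_exp_square)
    also have "\<dots> \<le> 2 * exp (4 * l\<^sup>2)" using x by simp
    finally show "(\<Sum>\<epsilon>\<in>{1, - 1}. exp (l * m r * s r * \<epsilon>)) \<le> 2 * exp (4 * l\<^sup>2)" by simp
  qed (auto intro!: sum_nonneg)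
  also have "\<dots> = 2 ^ card (\<rho> ` Z) * exp (4 * l\<^sup>2 * real (card (\<rho> ` Z)))"
    by (simp add: power_mult_distrib exp_of_nat_mult[symmetric] mult_ac)
  also have "\<dots> \<le> 2 ^ card (\<rho> ` Z) * 2"
  proof (intro mult_left_mono exp_half_le_2)
    have "4 * l\<^sup>2 * real (card (\<rho> ` Z)) \<le> 4 * l\<^sup>2 * real (card Z)"
      using card_image_le[OF Z, of \<rho>] by (intro mult_left_mono) auto
    with l show "4 * l\<^sup>2 * real (card (\<rho> ` Z)) \<le> 1 / 2" by simp
  qed simp
  finally show ?thesis by simp
qed

lemma one_plus_power_le_exp:
  fixes x :: real
  assumes "0 \<le> 1 + x"
  shows "(1 + x) ^ n \<le> exp (real n * x)"
proof -
  have "(1 + x) ^ n \<le> exp x ^ n" using assms by (intro power_mono) auto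
  then show ?thesis by (simp add: exp_of_nat_mult)
qed

context conj_basis
begin

text \<open>The constant density against the mixture, over random signs, of the perturbations that have a
  coefficient \<open>\<plusminus>g\<close> at every frequency in \<open>Z\<close>. The signs agree on conjugate frequencies, so that the
  densities are real. The squared norms do not depend on the signs. The upper bounds on \<open>g\<close> say
  that the densities are positive, that they lie in the ball, and that the mixture is
  indistinguishable from the constant density.\<close>

lemma minimax_risk_ge_signs:
  assumes Z: "finite Z" "e \<notin> Z" "\<sigma> ` Z \<subseteq> Z"
    and g: "0 \<le> g" "C * g * real (card Z) \<le> 1 / 2"
    and ball: "1 / (b e)\<^sup>2 + g\<^sup>2 * (\<Sum>w\<in>Z. 1 / (b w)\<^sup>2) \<le> 1"
    and chi: "8 * (real n * g\<^sup>2)\<^sup>2 * real (card Z) \<le> 1"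
  shows "ennreal ((g\<^sup>2 * (\<Sum>w\<in>Z. 1 / (a w)\<^sup>2))\<^sup>2 / 8) \<le> minimax_risk M \<psi> a b n"
proof -
  \<comment> \<open>A representative of each orbit of \<open>\<sigma>\<close>: the choice depends only on the set \<open>{w, \<sigma> w}\<close>.\<close>
  define \<rho> where "\<rho> w = (SOME v. v \<in> {w, \<sigma> w})" for w
  have \<rho>_in: "\<rho> w \<in> {w, \<sigma> w}" for w unfolding \<rho>_def by (rule someI[of _ w]) simp
  have \<rho>_\<sigma>: "\<rho> (\<sigma> w) = \<rho> w" for w by (simp add: \<rho>_def insert_commute)
  define T :: "('i \<Rightarrow> real) set" where "T = Pi\<^sub>E (\<rho> ` Z) (\<lambda>_. {1, - 1})"
  define F where "F = insert e Z"
  define c0 :: "'i \<Rightarrow> real" where "c0 w = (if w = e then 1 else 0)" for w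
  define c where "c t w = (if w = e then 1 else g * t (\<rho> w))" for t w
  have T: "finite T" "T \<noteq> {}" "card T = 2 ^ card (\<rho> ` Z)"
    using Z by (auto simp: T_def PiE_eq_empty_iff card_PiE numeral_2_eq_2 intro!: finite_PiE)
  have tsq: "t (\<rho> w) * t (\<rho> w) = 1" "\<bar>t (\<rho> w)\<bar> = 1" if "t \<in> T" "w \<in> Z" for t w
  proof -
    have "t (\<rho> w) \<in> {1, - 1}" using that by (auto simp: T_def PiE_def)
    then show "t (\<rho> w) * t (\<rho> w) = 1" "\<bar>t (\<rho> w)\<bar> = 1" by auto
  qed
  have sumF: "(\<Sum>w\<in>F. k w) = k e + (\<Sum>w\<in>Z. k w)" for k :: "'i \<Rightarrow> real"
    using Z by (simp add: F_def)
  have ne: "w \<noteq> e" if "w \<in> Z" for w using that Z by auto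
  have FZ: "F - {e} = Z" using Z by (auto simp: F_def)
  have \<sigma>_ne: "\<sigma> w = e \<longleftrightarrow> w = e" for w by (metis sigma_e sigma_invol)
  have adm0: "admissible F c0"
    using Z by (auto simp: admissible_def F_def c0_def \<sigma>_ne insert_Diff_if)
  have adm: "admissible F (c t)" if t: "t \<in> T" for t
  proof -
    have "(\<Sum>w\<in>Z. \<bar>c t w\<bar>) = (\<Sum>w\<in>Z. g)"
      using t g by (intro sum.cong) (auto simp: c_def abs_mult tsq ne)
    then have "C * (\<Sum>w\<in>F - {e}. \<bar>c t w\<bar>) \<le> 1 / 2"
      using g by (simp add: FZ mult_ac)
    moreover have "\<forall>w\<in>F. c t (\<sigma> w) = c t w" by (simp add: c_def \<rho>_\<sigma> \<sigma>_ne)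
    ultimately show ?thesis using Z by (auto simp: admissible_def F_def c_def)
  qed
  have sq: "(\<Sum>w\<in>F. (c t w)\<^sup>2 / (d w)\<^sup>2) = 1 / (d e)\<^sup>2 + g\<^sup>2 * (\<Sum>w\<in>Z. 1 / (d w)\<^sup>2)"
    if t: "t \<in> T" for t and d :: "'i \<Rightarrow> real"
  proof -
    have "(\<Sum>w\<in>Z. (c t w)\<^sup>2 / (d w)\<^sup>2) = (\<Sum>w\<in>Z. g\<^sup>2 * (1 / (d w)\<^sup>2))"
      using t by (intro sum.cong) (auto simp: c_def ne power_mult_distrib power2_eq_square tsq)
    then show ?thesis by (simp add: sumF sum_distrib_left) (simp add: c_def)
  qed
  have sq0: "(\<Sum>w\<in>F. (c0 w)\<^sup>2 / (d w)\<^sup>2) = 1 / (d e)\<^sup>2" for d :: "'i \<Rightarrow> real"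
    using ne by (simp add: sumF c0_def)
  have h0: "AE x in M. perturbed F c0 x = 1"
    using perturbed_eq_AE[OF adm0] one
  proof eventually_elim
    case (elim x)
    have "(\<Sum>w\<in>F. complex_of_real (c0 w) * \<psi> w x) = (\<Sum>w\<in>F. if w = e then 1 else 0)"
      using elim(2) by (intro sum.cong) (auto simp: c0_def)
    also have "\<dots> = 1" using Z by (simp add: F_def)
    finally show ?case using elim(1) by simp
  qed
  have pair: "(\<integral>\<^sup>+x. ennreal (perturbed F (c s) x * perturbed F (c t) x / perturbed F c0 x) \<partial>M) ^ n
      \<le> ennreal (exp (real n * g\<^sup>2 * (\<Sum>w\<in>Z. s (\<rho> w) * t (\<rho> w))))" if s: "s \<in> T" and t: "t \<in> T" for s t
  proof -
    define x where "x = g\<^sup>2 * (\<Sum>w\<in>Z. s (\<rho> w) * t (\<rho> w))"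
    have nn: "0 \<le> perturbed F k y" for k y using perturbed_ge[of F k y] by linarith
    have "(\<Sum>w\<in>F. c s w * c t w) = 1 + (\<Sum>w\<in>Z. g\<^sup>2 * (s (\<rho> w) * t (\<rho> w)))"
      unfolding sumF by (intro arg_cong2[of _ _ _ _ "(+)"] sum.cong) (auto simp: c_def ne power2_eq_square)
    then have int: "(LINT y|M. perturbed F (c s) y * perturbed F (c t) y) = 1 + x"
      using integral_perturbed_product[OF adm[OF s] adm[OF t]] by (simp add: x_def sum_distrib_left)
    have "(\<integral>\<^sup>+y. ennreal (perturbed F (c s) y * perturbed F (c t) y / perturbed F c0 y) \<partial>M)
        = (\<integral>\<^sup>+y. ennreal (perturbed F (c s) y * perturbed F (c t) y) \<partial>M)"
      using h0 by (intro nn_integral_cong_AE) (auto elim!: eventually_mono)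
    also have "\<dots> = ennreal (1 + x)"
      using int nn perturbed_product_integrable[OF adm[OF s] adm[OF t]]
      by (subst nn_integral_eq_integral) auto
    finally have eq: "(\<integral>\<^sup>+y. ennreal (perturbed F (c s) y * perturbed F (c t) y / perturbed F c0 y) \<partial>M)
        = ennreal (1 + x)" .
    have "0 \<le> 1 + x"
      unfolding int[symmetric] using nn by (intro integral_nonneg_AE) auto
    then show ?thesis
      using one_plus_power_le_exp[of x n] unfolding eq
      by (simp add: ennreal_power x_def mult.assoc ennreal_leI)
  qed
  have fibre: "card {w \<in> Z. \<rho> w = r} \<le> 2" for r
  proof -
    have "{w \<in> Z. \<rho> w = r} \<subseteq> {r, \<sigma> r}"
    proof
      fix w assume "w \<in> {w \<in> Z. \<rho> w = r}"
      then show "w \<in> {r, \<sigma> r}" using \<rho>_in[of w] sigma_invol[of w] by auto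
    qed
    then have "card {w \<in> Z. \<rho> w = r} \<le> card {r, \<sigma> r}" by (intro card_mono) auto
    also have "\<dots> \<le> 2" by (simp add: card_insert_if)
    finally show ?thesis .
  qed
  have "ennreal ((1 / (a e)\<^sup>2 + g\<^sup>2 * (\<Sum>w\<in>Z. 1 / (a w)\<^sup>2) - 1 / (a e)\<^sup>2)\<^sup>2 / 8) \<le> minimax_risk M \<psi> a b n"
  proof (rule minimax_risk_ge_mixture[OF T(1,2) adm0 adm _ _ sq0 sq])
    have "0 \<le> g\<^sup>2 * (\<Sum>w\<in>Z. 1 / (b w)\<^sup>2)" by (simp add: sum_nonneg)
    then show "(\<Sum>w\<in>F. (c0 w)\<^sup>2 / (b w)\<^sup>2) \<le> 1" using ball unfolding sq0 by linarith
    show "(\<Sum>w\<in>F. (c t w)\<^sup>2 / (b w)\<^sup>2) \<le> 1" if "t \<in> T" for t using ball sq[OF that] by simp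
    have "(\<Sum>s\<in>T. \<Sum>t\<in>T. (\<integral>\<^sup>+x. ennreal (perturbed F (c s) x * perturbed F (c t) x / perturbed F c0 x) \<partial>M) ^ n)
        \<le> (\<Sum>s\<in>T. \<Sum>t\<in>T. ennreal (exp (real n * g\<^sup>2 * (\<Sum>w\<in>Z. s (\<rho> w) * t (\<rho> w)))))"
      using pair by (intro sum_mono) auto
    also have "\<dots> = ennreal (\<Sum>s\<in>T. \<Sum>t\<in>T. exp (real n * g\<^sup>2 * (\<Sum>w\<in>Z. s (\<rho> w) * t (\<rho> w))))"
      by (simp add: sum_nonneg)
    also have "\<dots> \<le> ennreal (\<Sum>s\<in>T. 2 * real (card T))"
      using sum_exp_signs_le[OF Z(1) fibre _ chi] by (intro ennreal_leI sum_mono) (simp add: T(3) flip: T_def)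
    also have "\<dots> = 2 * ennreal ((real (card T))\<^sup>2)"
      by (simp add: power2_eq_square ennreal_mult'' mult_ac)
    finally show "(\<Sum>s\<in>T. \<Sum>t\<in>T. (\<integral>\<^sup>+x. ennreal (perturbed F (c s) x * perturbed F (c t) x / perturbed F c0 x) \<partial>M) ^ n)
        \<le> 2 * ennreal ((real (card T))\<^sup>2)" .
  qed
  then show ?thesis by simp
qed

text \<open>Two densities that differ by \<open>\<delta>\<close> in the coefficients of one conjugate pair. Around the constant
  density the squared norm varies only by \<open>\<delta>\<^sup>2\<close>; the base coefficient \<open>g\<close> makes it vary by \<open>g * \<delta>\<close>,
  while \<open>\<delta>\<close> of order \<open>n\<close> to the power \<open>- 1 / 2\<close> keeps the two samples indistinguishable.\<close>

lemma minimax_risk_ge_two_point: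
  assumes z: "z \<noteq> e" and g: "0 \<le> \<delta>" "\<delta> \<le> g" "8 * C * g \<le> 1"
    and ball: "1 / (b e)\<^sup>2 + (2 * g)\<^sup>2 * (\<Sum>w\<in>{z, \<sigma> z}. 1 / (b w)\<^sup>2) \<le> 1"
    and chi: "8 * real n * \<delta>\<^sup>2 \<le> 1"
  shows "ennreal ((g * \<delta> / (a z)\<^sup>2)\<^sup>2 / 2) \<le> minimax_risk M \<psi> a b n"
proof -
  define G where "G = {z, \<sigma> z}"
  define F where "F = insert e G"
  define c where "c r w = (if w = e then 1 else r)" for r :: real and w
  have \<sigma>_ne: "\<sigma> w = e \<longleftrightarrow> w = e" for w by (metis sigma_e sigma_invol)
  have G: "finite G" "e \<notin> G" "\<sigma> ` G \<subseteq> G" "card G \<le> 2"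
    using z \<sigma>_ne[of z] by (auto simp: G_def card_insert_if)
  have sumF: "(\<Sum>w\<in>F. k w) = k e + (\<Sum>w\<in>G. k w)" for k :: "'i \<Rightarrow> real"
    using G by (simp add: F_def)
  have ne: "w \<noteq> e" if "w \<in> G" for w using that G by auto
  have FG: "F - {e} = G" using G by (auto simp: F_def)
  have g0: "0 \<le> g" using g by simp
  have adm: "admissible F (c r)" if r: "0 \<le> r" "r \<le> 2 * g" for r
  proof -
    have "(\<Sum>w\<in>G. \<bar>c r w\<bar>) = real (card G) * r"
      using r by (simp add: c_def ne cong: sum.cong)
    also have "\<dots> \<le> 2 * (2 * g)" using G r by (intro mult_mono) auto
    finally have "C * (\<Sum>w\<in>G. \<bar>c r w\<bar>) \<le> C * (2 * (2 * g))"
      using bound_ge_1 by (intro mult_left_mono) auto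
    with g have "C * (\<Sum>w\<in>F - {e}. \<bar>c r w\<bar>) \<le> 1 / 2" by (simp add: FG)
    then show ?thesis using G by (auto simp: admissible_def F_def c_def \<sigma>_ne)
  qed
  have sq: "(\<Sum>w\<in>F. (c r w)\<^sup>2 / (d w)\<^sup>2) = 1 / (d e)\<^sup>2 + r\<^sup>2 * (\<Sum>w\<in>G. 1 / (d w)\<^sup>2)" for r d
    by (simp add: sumF sum_distrib_left c_def ne cong: sum.cong)
  have ball': "(\<Sum>w\<in>F. (c r w)\<^sup>2 / (b w)\<^sup>2) \<le> 1" if r: "0 \<le> r" "r \<le> 2 * g" for r
  proof -
    have "r\<^sup>2 * (\<Sum>w\<in>G. 1 / (b w)\<^sup>2) \<le> (2 * g)\<^sup>2 * (\<Sum>w\<in>G. 1 / (b w)\<^sup>2)"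
      using r by (intro mult_right_mono power_mono sum_nonneg) auto
    with ball show ?thesis by (simp add: sq G_def[symmetric])
  qed
  define h0 where "h0 = perturbed F (c g)"
  define h1 where "h1 = perturbed F (c (g + \<delta>))"
  have adm0: "admissible F (c g)" and adm1: "admissible F (c (g + \<delta>))"
    using g by (auto intro!: adm)
  note ints = perturbed_integrable[OF adm0] perturbed_integrable[OF adm1]
    perturbed_product_integrable[OF adm0 adm0] perturbed_product_integrable[OF adm1 adm1]
    perturbed_product_integrable[OF adm1 adm0]
  have ge: "1 / 2 \<le> h0 x" "1 / 2 \<le> h1 x" for x unfolding h0_def h1_def by (rule perturbed_ge)+
  \<comment> \<open>The chi-square divergence is at most twice the squared distance in L2, as \<open>h0\<close> is at least \<open>1 / 2\<close>.\<close>
  have pw: "h1 x * h1 x / h0 x \<le> 2 * h1 x - h0 x + 2 * (h1 x * h1 x - 2 * (h1 x * h0 x) + h0 x * h0 x)" for x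
  proof -
    have "h1 x * h1 x / h0 x = 2 * h1 x - h0 x + (h1 x - h0 x)\<^sup>2 * (1 / h0 x)"
      using ge(1)[of x] by (simp add: field_simps power2_eq_square)
    moreover have "1 / h0 x \<le> 2" using ge(1)[of x] by (simp add: field_simps)
    then have "(h1 x - h0 x)\<^sup>2 * (1 / h0 x) \<le> (h1 x - h0 x)\<^sup>2 * 2" by (intro mult_left_mono) auto
    ultimately show ?thesis by (simp add: power2_eq_square algebra_simps)
  qed
  have pw0: "0 \<le> h1 x * h1 x / h0 x" for x using ge[of x] by simp
  have "(\<integral>\<^sup>+x. ennreal (h1 x * h1 x / h0 x) \<partial>M)
      \<le> (\<integral>\<^sup>+x. ennreal (2 * h1 x - h0 x + 2 * (h1 x * h1 x - 2 * (h1 x * h0 x) + h0 x * h0 x)) \<partial>M)"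
    using pw by (intro nn_integral_mono ennreal_leI) auto
  also have "\<dots> = ennreal (LINT x|M. 2 * h1 x - h0 x + 2 * (h1 x * h1 x - 2 * (h1 x * h0 x) + h0 x * h0 x))"
    using ints order_trans[OF pw0 pw] unfolding h0_def h1_def by (intro nn_integral_eq_integral) auto
  also have "(LINT x|M. 2 * h1 x - h0 x + 2 * (h1 x * h1 x - 2 * (h1 x * h0 x) + h0 x * h0 x))
      = 2 * 1 - 1 + 2 * ((\<Sum>w\<in>F. c (g + \<delta>) w * c (g + \<delta>) w) - 2 * (\<Sum>w\<in>F. c (g + \<delta>) w * c g w)
          + (\<Sum>w\<in>F. c g w * c g w))"
    using ints unfolding h0_def h1_def
    by (simp add: integral_perturbed[OF adm0] integral_perturbed[OF adm1]
        integral_perturbed_product[OF adm0 adm0] integral_perturbed_product[OF adm1 adm1]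
        integral_perturbed_product[OF adm1 adm0])
  also have "\<dots> = 1 + 2 * (real (card G) * \<delta>\<^sup>2)"
    by (simp add: sumF c_def ne power2_eq_square algebra_simps cong: sum.cong)
  also have "ennreal \<dots> \<le> ennreal (1 + 4 * \<delta>\<^sup>2)"
    using G(4) by (intro ennreal_leI) (simp add: mult_right_mono)
  finally have "(\<integral>\<^sup>+x. ennreal (h1 x * h1 x / h0 x) \<partial>M) ^ n \<le> ennreal (1 + 4 * \<delta>\<^sup>2) ^ n"
    by (rule power_mono) simp
  also have "\<dots> = ennreal ((1 + 4 * \<delta>\<^sup>2) ^ n)" by (rule ennreal_power) simp
  also have "\<dots> \<le> ennreal (exp (real n * (4 * \<delta>\<^sup>2)))"
    by (intro ennreal_leI one_plus_power_le_exp) simp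
  also have "\<dots> \<le> ennreal 2" using chi by (intro ennreal_leI exp_half_le_2) simp
  finally have chi': "(\<integral>\<^sup>+x. ennreal (h1 x * h1 x / h0 x) \<partial>M) ^ n \<le> 2" by simp
  define s where "s = (\<Sum>w\<in>G. 1 / (a w)\<^sup>2)"
  have "ennreal (((1 / (a e)\<^sup>2 + (g + \<delta>)\<^sup>2 * s) - (1 / (a e)\<^sup>2 + g\<^sup>2 * s))\<^sup>2 / 8) \<le> minimax_risk M \<psi> a b n"
  proof (rule minimax_risk_ge_mixture[where T = "{()}" and F = F and k = "c g" and c = "\<lambda>_. c (g + \<delta>)"])
    show "(\<Sum>s\<in>{()}. \<Sum>t\<in>{()}. (\<integral>\<^sup>+x. ennreal (perturbed F (c (g + \<delta>)) x * perturbed F (c (g + \<delta>)) x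
        / perturbed F (c g) x) \<partial>M) ^ n) \<le> 2 * ennreal ((real (card {()}))\<^sup>2)"
      using chi' by (simp add: h0_def h1_def)
  qed (use g adm0 adm1 in \<open>auto simp: sq s_def intro!: ball'[unfolded sq]\<close>)
  moreover have "(g * \<delta> / (a z)\<^sup>2)\<^sup>2 / 2 \<le> ((1 / (a e)\<^sup>2 + (g + \<delta>)\<^sup>2 * s) - (1 / (a e)\<^sup>2 + g\<^sup>2 * s))\<^sup>2 / 8"
  proof -
    have "1 / (a z)\<^sup>2 \<le> s" unfolding s_def using G by (intro member_le_sum) (auto simp: G_def)
    then have "2 * g * \<delta> * (1 / (a z)\<^sup>2) \<le> (2 * g * \<delta> + \<delta>\<^sup>2) * s"
      using g g0 by (intro mult_mono) auto
    define y where "y = g * \<delta> / (a z)\<^sup>2"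
    have "2 * y \<le> (2 * g * \<delta> + \<delta>\<^sup>2) * s" using \<open>2 * g * \<delta> * _ \<le> _\<close> by (simp add: y_def)
    then have "(2 * y)\<^sup>2 \<le> ((2 * g * \<delta> + \<delta>\<^sup>2) * s)\<^sup>2"
      using g g0 by (intro power_mono) (auto simp: y_def)
    moreover have "(1 / (a e)\<^sup>2 + (g + \<delta>)\<^sup>2 * s) - (1 / (a e)\<^sup>2 + g\<^sup>2 * s) = (2 * g * \<delta> + \<delta>\<^sup>2) * s"
      by (simp add: power2_eq_square algebra_simps)
    ultimately show ?thesis by (simp add: power_mult_distrib flip: y_def)
  qed
  ultimately show ?thesis using ennreal_leI order_trans by blast
qed

end

section \<open>Frequencies and cutoff sums\<close>

lemma freq_norm_zero [simp]: "freq_norm 0 = 0"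
  by (simp add: freq_norm_def infnorm_0 flip: zero_vec_def)

lemma freq_ball:
  fixes \<zeta> :: real
  assumes "0 \<le> \<zeta>"
  shows finite_freq_ball: "finite {z :: int ^ 'd. freq_norm z \<le> \<zeta>}"
    and card_freq_ball_le: "real (card {z :: int ^ 'd. freq_norm z \<le> \<zeta>}) \<le> (2 * \<zeta> + 1) ^ CARD('d)"
proof -
  define m where "m = \<lfloor>\<zeta>\<rfloor>"
  have m: "0 \<le> m" "real_of_int m \<le> \<zeta>" using assms by (auto simp: m_def)
  let ?B = "Pi\<^sub>E (UNIV :: 'd set) (\<lambda>_. {- m..m})"
  have sub: "{z :: int ^ 'd. freq_norm z \<le> \<zeta>} \<subseteq> vec_lambda ` ?B"
  proof
    fix z :: "int ^ 'd" assume "z \<in> {z. freq_norm z \<le> \<zeta>}"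
    then have "\<bar>real_of_int (z $ i)\<bar> \<le> \<zeta>" for i
      using component_le_infnorm_cart[of "\<chi> i. real_of_int (z $ i)" i] by (simp add: freq_norm_def)
    then have "\<bar>z $ i\<bar> \<le> m" for i by (simp add: m_def le_floor_iff)
    then have "vec_nth z \<in> ?B" by (auto simp: abs_le_iff minus_le_iff)
    then show "z \<in> vec_lambda ` ?B" by (metis image_eqI vec_nth_inverse)
  qed
  have fin: "finite ?B" by (intro finite_PiE) auto
  show "finite {z :: int ^ 'd. freq_norm z \<le> \<zeta>}" using sub fin finite_surj by blast
  have "card {z :: int ^ 'd. freq_norm z \<le> \<zeta>} \<le> card ?B" using sub fin by (rule surj_card_le[rotated])
  also have "card ?B = nat (2 * m + 1) ^ CARD('d)" by (simp add: card_PiE algebra_simps)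
  finally have "real (card {z :: int ^ 'd. freq_norm z \<le> \<zeta>}) \<le> real (nat (2 * m + 1)) ^ CARD('d)"
    by (metis of_nat_le_iff of_nat_power)
  also have "\<dots> \<le> (2 * \<zeta> + 1) ^ CARD('d)" using m by (intro power_mono) auto
  finally show "real (card {z :: int ^ 'd. freq_norm z \<le> \<zeta>}) \<le> (2 * \<zeta> + 1) ^ CARD('d)" .
qed

lemma cutoff_sum_split:
  fixes a :: "int ^ 'd \<Rightarrow> real"
  assumes "0 \<le> \<zeta>"
  shows "cutoff_sum a \<zeta> = 1 / (a 0)\<^sup>2 + (\<Sum>z\<in>{z. freq_norm z \<le> \<zeta>} - {0}. 1 / (a z)\<^sup>2)"
  unfolding cutoff_sum_def using assms by (subst sum.remove[OF finite_freq_ball]) auto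

lemma cutoff_sum_nonneg: "0 \<le> cutoff_sum a \<zeta>"
  unfolding cutoff_sum_def by (intro sum_nonneg) auto

lemma cutoff_sum_pos:
  assumes "a 0 > 0" "0 \<le> \<zeta>"
  shows "0 < cutoff_sum a \<zeta>"
proof -
  have "0 < 1 / (a 0)\<^sup>2" using assms by simp
  moreover have "0 \<le> (\<Sum>z\<in>{z. freq_norm z \<le> \<zeta>} - {0}. 1 / (a z)\<^sup>2)" by (intro sum_nonneg) auto
  ultimately show ?thesis unfolding cutoff_sum_split[OF assms(2)] by linarith
qed

lemma exists_nonzero_frequency: "\<exists>z :: int ^ 'd. z \<noteq> 0"
  by (rule exI[of _ "\<chi> i. 1"]) (simp add: vec_eq_iff)

text \<open>The squared norms of the perturbed densities differ from that of the constant density by a sum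
  over the frequencies other than 0. Omitting the term of 0 loses only a constant factor once the
  cutoff reaches some other frequency.\<close>

lemma cutoff_sum_le_nonconstant_part:
  fixes a :: "int ^ 'd \<Rightarrow> real"
  assumes a: "\<forall>z. a z > 0"
  obtains \<kappa> r where "0 < \<kappa>" "0 \<le> r"
    "\<And>\<zeta>. r \<le> \<zeta> \<Longrightarrow> \<kappa> * cutoff_sum a \<zeta> \<le> (\<Sum>z\<in>{z. freq_norm z \<le> \<zeta>} - {0}. 1 / (a z)\<^sup>2)"
proof -
  obtain z1 :: "int ^ 'd" where z1: "z1 \<noteq> 0" using exists_nonzero_frequency by blast
  define \<alpha> where "\<alpha> = 1 / (a z1)\<^sup>2"
  define \<beta> where "\<beta> = 1 / (a 0)\<^sup>2"
  have pos: "0 < \<alpha>" "0 < \<beta>" using a by (auto simp: \<alpha>_def \<beta>_def less_imp_neq[THEN not_sym])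
  have r: "0 \<le> freq_norm z1" by (simp add: freq_norm_def infnorm_pos_le)
  show ?thesis
  proof (rule that[of "\<alpha> / (\<alpha> + \<beta>)" "freq_norm z1"])
    fix \<zeta> assume \<zeta>: "freq_norm z1 \<le> \<zeta>"
    define A where "A = (\<Sum>z\<in>{z. freq_norm z \<le> \<zeta>} - {0}. 1 / (a z)\<^sup>2)"
    have "\<alpha> \<le> A"
      unfolding \<alpha>_def A_def using z1 \<zeta> r finite_freq_ball[of \<zeta>, where ?'d = 'd] by (intro member_le_sum) auto
    then have "\<alpha> * \<beta> \<le> A * \<beta>" using pos by (intro mult_right_mono) auto
    then show "\<alpha> / (\<alpha> + \<beta>) * cutoff_sum a \<zeta> \<le> A"
      using pos r \<zeta> by (simp add: cutoff_sum_split A_def[symmetric] \<beta>_def[symmetric] field_simps)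
  qed (use pos r in auto)
qed

section \<open>Asymptotic lower bounds\<close>

text \<open>The sign construction on all nonzero frequencies up to \<open>\<zeta> n\<close>, with coefficient a small multiple
  of \<open>\<gamma> n\<close>. There are of order \<open>\<zeta> n ^ CARD('d)\<close> such frequencies, so the three bounds by \<open>K\<close> are, up
  to constants, positivity, membership in the ball, and indistinguishability; the factor \<open>\<epsilon>\<close> absorbs
  the constants.\<close>

lemma eventually_minimax_risk_ge_signs:
  fixes M :: "'a measure" and \<psi> :: "int ^ 'd \<Rightarrow> 'a \<Rightarrow> complex" and a b :: "int ^ 'd \<Rightarrow> real"
    and \<zeta> \<gamma> :: "nat \<Rightarrow> real"
  assumes basis: "conj_basis M \<psi> C \<sigma> 0" and sym: "\<And>z. freq_norm (\<sigma> z) = freq_norm z"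
    and a: "\<forall>z. a z > 0" and b0: "b 0 > 1"
    and \<zeta>: "filterlim \<zeta> at_top sequentially"
    and \<gamma>: "\<forall>\<^sub>F n in sequentially. 0 \<le> \<gamma> n \<and> \<gamma> n * \<zeta> n ^ CARD('d) \<le> K \<and> (\<gamma> n)\<^sup>2 * cutoff_sum b (\<zeta> n) \<le> K
          \<and> (real n)\<^sup>2 * \<gamma> n ^ 4 * \<zeta> n ^ CARD('d) \<le> K"
  shows "\<exists>c>0. \<forall>\<^sub>F n in sequentially.
           ennreal (c * (\<gamma> n ^ 4 * (cutoff_sum a (\<zeta> n))\<^sup>2)) \<le> minimax_risk M \<psi> a b n"
proof -
  interpret conj_basis M \<psi> C \<sigma> "0 :: int ^ 'd" by fact
  obtain \<kappa> r where \<kappa>: "0 < \<kappa>" "0 \<le> r"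
    "\<And>\<zeta>. r \<le> \<zeta> \<Longrightarrow> \<kappa> * cutoff_sum a \<zeta> \<le> (\<Sum>z\<in>{z. freq_norm z \<le> \<zeta>} - {0}. 1 / (a z)\<^sup>2)"
    using cutoff_sum_le_nonconstant_part[OF a] by blast
  define L where "L = max K 1"
  \<comment> \<open>The inverse of \<open>\<epsilon>\<close>: the first entry serves positivity and indistinguishability, the second the ball.\<close>
  define Q where "Q = max (8 * C * L * 3 ^ CARD('d)) (L / (1 - 1 / (b 0)\<^sup>2))"
  have C: "1 \<le> C" by (rule bound_ge_1)
  have L: "1 \<le> L" "K \<le> L" by (auto simp: L_def)
  have P: "(1::real) \<le> 3 ^ CARD('d)" by simp
  have slack: "0 < 1 - 1 / (b 0)\<^sup>2" using b0 by (simp add: field_simps one_less_power)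
  have CL: "1 \<le> C * L" using mult_mono[of 1 C 1 L] C L by simp
  have CLP: "1 \<le> C * L * 3 ^ CARD('d)" using mult_mono[of 1 "C * L" 1 "3 ^ CARD('d)"] CL P by simp
  have Q: "8 \<le> Q" "8 * C * L * 3 ^ CARD('d) \<le> Q" "L / (1 - 1 / (b 0)\<^sup>2) \<le> Q"
    using CLP by (auto simp: Q_def)
  define \<epsilon> where "\<epsilon> = 1 / Q"
  have \<epsilon>: "0 < \<epsilon>" "\<epsilon> \<le> 1" using Q by (auto simp: \<epsilon>_def)
  have \<epsilon>C: "8 * C * L * 3 ^ CARD('d) * \<epsilon> \<le> 1" using Q by (simp add: \<epsilon>_def field_simps)
  have "L \<le> Q * (1 - 1 / (b 0)\<^sup>2)" using Q(3) slack by (simp add: pos_divide_le_eq)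
  then have \<epsilon>b: "\<epsilon> * L \<le> 1 - 1 / (b 0)\<^sup>2" using Q(1) by (simp add: \<epsilon>_def field_simps)
  have \<epsilon>2: "\<epsilon>\<^sup>2 \<le> \<epsilon>" using \<epsilon> power_decreasing[of 1 2 \<epsilon>] by simp
  have \<epsilon>4: "\<epsilon> ^ 4 \<le> \<epsilon>" using \<epsilon> power_decreasing[of 1 4 \<epsilon>] by simp
  have large: "\<forall>\<^sub>F n in sequentially. max 1 r \<le> \<zeta> n" using \<zeta> unfolding filterlim_at_top by blast
  have "\<forall>\<^sub>F n in sequentially. ennreal (\<epsilon> ^ 4 * \<kappa>\<^sup>2 / 8 * (\<gamma> n ^ 4 * (cutoff_sum a (\<zeta> n))\<^sup>2))
      \<le> minimax_risk M \<psi> a b n"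
    using \<gamma> large
  proof eventually_elim
    case (elim n)
    define Z where "Z = {z :: int ^ 'd. freq_norm z \<le> \<zeta> n} - {0}"
    define N where "N = real (card Z)"
    define t where "t = \<zeta> n ^ CARD('d)"
    define g where "g = \<epsilon> * \<gamma> n"
    have \<zeta>n: "1 \<le> \<zeta> n" "r \<le> \<zeta> n" using elim by auto
    have fin: "finite {z :: int ^ 'd. freq_norm z \<le> \<zeta> n}" using \<zeta>n by (intro finite_freq_ball) auto
    have "N \<le> real (card {z :: int ^ 'd. freq_norm z \<le> \<zeta> n})"
      unfolding N_def Z_def using fin by (intro of_nat_mono card_mono) auto
    also have "\<dots> \<le> (2 * \<zeta> n + 1) ^ CARD('d)" using \<zeta>n by (intro card_freq_ball_le) auto
    also have "\<dots> \<le> (3 * \<zeta> n) ^ CARD('d)" using \<zeta>n by (intro power_mono) auto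
    finally have N: "N \<le> 3 ^ CARD('d) * t" by (simp add: t_def power_mult_distrib)
    have g0: "0 \<le> g" using \<epsilon> elim by (simp add: g_def)
    have "ennreal ((g\<^sup>2 * (\<Sum>w\<in>Z. 1 / (a w)\<^sup>2))\<^sup>2 / 8) \<le> minimax_risk M \<psi> a b n"
    proof (rule minimax_risk_ge_signs)
      show "finite Z" "0 \<notin> Z" using fin by (auto simp: Z_def)
      show "\<sigma> ` Z \<subseteq> Z"
      proof (rule image_subsetI)
        fix z assume z: "z \<in> Z"
        have "\<sigma> z \<noteq> 0"
        proof
          assume "\<sigma> z = 0"
          then have "\<sigma> (\<sigma> z) = \<sigma> 0" by (rule arg_cong)
          with z show False by (simp add: Z_def)
        qed
        with z show "\<sigma> z \<in> Z" by (simp add: Z_def sym)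
      qed
      show "0 \<le> g" by fact
      have "C * g * N \<le> C * g * (3 ^ CARD('d) * t)" using C g0 N by (intro mult_left_mono) auto
      also have "\<dots> = (C * \<epsilon> * 3 ^ CARD('d)) * (\<gamma> n * t)" by (simp add: g_def)
      also have "\<dots> \<le> (C * \<epsilon> * 3 ^ CARD('d)) * L"
        using elim C \<epsilon> L by (intro mult_left_mono) (auto simp: t_def)
      also have "\<dots> \<le> 1 / 2" using \<epsilon>C by (simp add: mult_ac)
      finally show "C * g * real (card Z) \<le> 1 / 2" by (simp add: N_def)
      have "(\<Sum>w\<in>Z. 1 / (b w)\<^sup>2) \<le> cutoff_sum b (\<zeta> n)"
        using \<zeta>n by (subst cutoff_sum_split) (auto simp: Z_def)
      then have "g\<^sup>2 * (\<Sum>w\<in>Z. 1 / (b w)\<^sup>2) \<le> g\<^sup>2 * cutoff_sum b (\<zeta> n)" by (intro mult_left_mono) auto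
      also have "\<dots> = \<epsilon>\<^sup>2 * ((\<gamma> n)\<^sup>2 * cutoff_sum b (\<zeta> n))" by (simp add: g_def power_mult_distrib)
      also have "\<dots> \<le> \<epsilon> * L" using elim \<epsilon>2 \<epsilon> L by (intro mult_mono) (auto simp: cutoff_sum_nonneg)
      finally show "1 / (b 0)\<^sup>2 + g\<^sup>2 * (\<Sum>w\<in>Z. 1 / (b w)\<^sup>2) \<le> 1" using \<epsilon>b by linarith
      have "8 * (real n * g\<^sup>2)\<^sup>2 * N \<le> 8 * (real n * g\<^sup>2)\<^sup>2 * (3 ^ CARD('d) * t)"
        using N by (intro mult_left_mono) auto
      also have "\<dots> = 8 * \<epsilon> ^ 4 * 3 ^ CARD('d) * ((real n)\<^sup>2 * \<gamma> n ^ 4 * t)"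
        by (simp add: g_def power_mult_distrib flip: power_mult)
      also have "\<dots> \<le> 8 * \<epsilon> * 3 ^ CARD('d) * L"
        using elim \<epsilon>4 \<epsilon> L \<zeta>n by (intro mult_mono) (auto simp: t_def)
      also have "\<dots> \<le> C * (8 * \<epsilon> * 3 ^ CARD('d) * L)"
        using mult_right_mono[OF C, of "8 * \<epsilon> * 3 ^ CARD('d) * L"] \<epsilon> L by simp
      also have "\<dots> \<le> 1" using \<epsilon>C by (simp add: mult_ac)
      finally show "8 * (real n * g\<^sup>2)\<^sup>2 * real (card Z) \<le> 1" by (simp add: N_def)
    qed
    moreover have "\<epsilon> ^ 4 * \<kappa>\<^sup>2 / 8 * (\<gamma> n ^ 4 * (cutoff_sum a (\<zeta> n))\<^sup>2) \<le> (g\<^sup>2 * (\<Sum>w\<in>Z. 1 / (a w)\<^sup>2))\<^sup>2 / 8"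
    proof -
      have "(g\<^sup>2 * (\<kappa> * cutoff_sum a (\<zeta> n)))\<^sup>2 \<le> (g\<^sup>2 * (\<Sum>w\<in>Z. 1 / (a w)\<^sup>2))\<^sup>2"
        using \<kappa>(3)[OF \<zeta>n(2)] \<kappa>(1) by (intro power_mono mult_left_mono) (auto simp: Z_def cutoff_sum_nonneg)
      moreover have "(g\<^sup>2 * (\<kappa> * cutoff_sum a (\<zeta> n)))\<^sup>2 = \<epsilon> ^ 4 * \<kappa>\<^sup>2 * (\<gamma> n ^ 4 * (cutoff_sum a (\<zeta> n))\<^sup>2)"
        by (simp add: g_def power_mult_distrib flip: power_mult)
      ultimately show ?thesis by simp
    qed
    ultimately show ?case using ennreal_leI order_trans by blast
  qed
  moreover have "0 < \<epsilon> ^ 4 * \<kappa>\<^sup>2 / 8" using \<epsilon> \<kappa> by simp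
  ultimately show ?thesis by blast
qed

text \<open>The rate \<open>1 / n\<close> is the same for all weights: it comes from a single pair of conjugate
  frequencies, with \<open>\<delta>\<^sup>2 = 1 / (8 * n)\<close>. The condition \<open>b e > 1\<close> leaves room in the ball around the
  constant density.\<close>

lemma (in conj_basis) eventually_minimax_risk_ge_parametric:
  assumes z: "z \<noteq> e" and a: "a z > 0" and b: "b e > 1"
  shows "\<exists>c>0. \<forall>\<^sub>F n in sequentially. ennreal (c * (1 / real n)) \<le> minimax_risk M \<psi> a b n"
proof -
  define s where "s = (\<Sum>w\<in>{z, \<sigma> z}. 1 / (b w)\<^sup>2)"
  define Q where "Q = max (8 * C) (4 * s / (1 - 1 / (b e)\<^sup>2))"
  define g where "g = 1 / Q"
  have slack: "0 < 1 - 1 / (b e)\<^sup>2" using b by (simp add: field_simps one_less_power)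
  have s: "0 \<le> s" unfolding s_def by (intro sum_nonneg) auto
  have Q: "8 \<le> Q" "8 * C \<le> Q" "4 * s / (1 - 1 / (b e)\<^sup>2) \<le> Q"
    using bound_ge_1 by (auto simp: Q_def)
  have g: "0 < g" "g \<le> 1" "8 * C * g \<le> 1" using Q by (auto simp: g_def field_simps)
  have "4 * s \<le> Q * (1 - 1 / (b e)\<^sup>2)" using Q(3) slack by (simp add: pos_divide_le_eq)
  then have "4 * g * s \<le> 1 - 1 / (b e)\<^sup>2" using Q(1) by (simp add: g_def field_simps)
  moreover have "g\<^sup>2 \<le> g" using g power_decreasing[of 1 2 g] by simp
  then have "(2 * g)\<^sup>2 * s \<le> 4 * g * s" using s by (simp add: power_mult_distrib mult_right_mono)
  ultimately have ball: "1 / (b e)\<^sup>2 + (2 * g)\<^sup>2 * s \<le> 1" by linarith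
  have "\<forall>\<^sub>F n in sequentially. 1 / (8 * g\<^sup>2) < real n"
    using filterlim_real_sequentially by (simp add: filterlim_at_top_dense)
  then have "\<forall>\<^sub>F n in sequentially. ennreal (g\<^sup>2 / (16 * (a z) ^ 4) * (1 / real n)) \<le> minimax_risk M \<psi> a b n"
    using eventually_gt_at_top[of 0]
  proof eventually_elim
    case (elim n)
    define \<delta> where "\<delta> = 1 / sqrt (8 * real n)"
    have \<delta>: "\<delta>\<^sup>2 = 1 / (8 * real n)" "0 \<le> \<delta>" using elim by (auto simp: \<delta>_def power_divide)
    have "1 < real n * (8 * g\<^sup>2)" using elim(1) g(1) by (subst (asm) pos_divide_less_eq) auto
    then have "1 / (8 * real n) \<le> g\<^sup>2" using elim(2) by (subst pos_divide_le_eq) (auto simp: mult_ac)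
    then have "\<delta>\<^sup>2 \<le> g\<^sup>2" by (simp only: \<delta>(1))
    then have "\<delta> \<le> g" by (rule power2_le_imp_le) (use g in simp)
    note \<delta> = \<delta> this
    have "ennreal ((g * \<delta> / (a z)\<^sup>2)\<^sup>2 / 2) \<le> minimax_risk M \<psi> a b n"
      using z \<delta> g ball elim by (intro minimax_risk_ge_two_point) (auto simp: s_def)
    moreover have "(g * \<delta> / (a z)\<^sup>2)\<^sup>2 / 2 = g\<^sup>2 / (16 * (a z) ^ 4) * (1 / real n)"
      by (simp add: power_mult_distrib power_divide \<delta>(1) flip: power_mult)
    ultimately show ?case by simp
  qed
  moreover have "0 < g\<^sup>2 / (16 * (a z) ^ 4)" using g a by simp
  ultimately show ?thesis by blast
qed

lemma eventually_ennreal_max: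
  fixes f g :: "nat \<Rightarrow> real"
  assumes "\<exists>c>0. \<forall>\<^sub>F n in sequentially. ennreal (c * f n) \<le> R n"
    and "\<exists>c>0. \<forall>\<^sub>F n in sequentially. ennreal (c * g n) \<le> R n"
    and nn: "\<And>n. 0 \<le> f n" "\<And>n. 0 \<le> g n"
  shows "\<exists>c>0. \<forall>\<^sub>F n in sequentially. ennreal (c * max (f n) (g n)) \<le> R n"
proof -
  obtain c1 c2 where c: "c1 > 0" "c2 > 0"
    and e1: "\<forall>\<^sub>F n in sequentially. ennreal (c1 * f n) \<le> R n"
    and e2: "\<forall>\<^sub>F n in sequentially. ennreal (c2 * g n) \<le> R n" using assms by blast
  from e1 e2 have "\<forall>\<^sub>F n in sequentially. ennreal (min c1 c2 * max (f n) (g n)) \<le> R n"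
  proof eventually_elim
    case (elim n)
    have "min c1 c2 * f n \<le> c1 * f n" "min c1 c2 * g n \<le> c2 * g n"
      using nn[of n] by (auto intro: mult_right_mono)
    then show ?case
      using elim by (auto simp: max_def intro: order_trans[OF ennreal_leI])
  qed
  with c show ?thesis by (intro exI[of _ "min c1 c2"]) auto
qed

lemma conj_basis_exists:
  fixes X :: "(real ^ 'd) set"
    and M :: "(real ^ 'd) measure"
    and \<psi> :: "int ^ 'd \<Rightarrow> real ^ 'd \<Rightarrow> complex"
  assumes sets: "sets M = sets (restrict_space borel X)"
    and mass: "emeasure M X = 1"
    and basis: "orthonormal_basis M \<psi>"
    and psi_zero: "AE x in M. \<psi> 0 x = 1"
    and bounded: "(SUP z. esssup M (\<lambda>x. ereal (cmod (\<psi> z x)))) < \<infinity>"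
    and conjugation: "\<forall>z. \<exists>w. freq_norm w = freq_norm z \<and> (AE x in M. cnj (\<psi> z x) = \<psi> w x)"
  obtains C \<sigma> where "conj_basis M \<psi> C \<sigma> 0" "\<And>z. freq_norm (\<sigma> z) = freq_norm z"
proof -
  have "space M = X" using sets_eq_imp_space_eq[OF sets] by (simp add: space_restrict_space)
  then have prob: "prob_space M" using mass by (intro prob_spaceI) simp
  obtain C where C: "(SUP z. esssup M (\<lambda>x. ereal (cmod (\<psi> z x)))) \<le> ereal C"
    using bounded by (metis ereal_dense2 less_imp_le infinity_ereal_def)
  obtain \<sigma> where \<sigma>: "\<And>z. freq_norm (\<sigma> z) = freq_norm z" "\<And>z. AE x in M. cnj (\<psi> z x) = \<psi> (\<sigma> z) x"
    using conjugation by metis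
  have "conj_basis M \<psi> C \<sigma> 0"
    unfolding conj_basis_def conj_basis_axioms_def
  proof (intro conjI allI)
    fix z w
    show "\<psi> z \<in> borel_measurable M" "coeff M \<psi> (\<psi> w) z = (if z = w then 1 else 0)"
      using basis by (auto simp: orthonormal_basis_def L2_def)
    have "esssup M (\<lambda>x. ereal (cmod (\<psi> z x))) \<le> ereal C"
      using C by (rule order_trans[OF SUP_upper[OF UNIV_I]])
    then show "AE x in M. cmod (\<psi> z x) \<le> C"
      using esssup_AE[of "\<lambda>x. ereal (cmod (\<psi> z x))" M]
      by (auto elim!: eventually_mono dest: order_trans)
  qed (use prob \<sigma> psi_zero in auto)
  with \<sigma>(1) show ?thesis using that by blast
qed

theorem theorem5:
  fixes X :: "(real ^ 'd) set"
    and M :: "(real ^ 'd) measure"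
    and \<psi> :: "int ^ 'd \<Rightarrow> real ^ 'd \<Rightarrow> complex"
    and a b :: "int ^ 'd \<Rightarrow> real"
  assumes "compact X"
    and "sets M = sets (restrict_space borel X)"
    and "emeasure M X = 1"
    and "\<forall>z. a z > 0"
    and "\<forall>z. b z > 0"
    and basis: "orthonormal_basis M \<psi>"
    and psi_zero: "AE x in M. \<psi> 0 x = 1"
    and bounded: "(SUP z. esssup M (\<lambda>x. ereal (cmod (\<psi> z x)))) < \<infinity>"
    and conjugation: "\<forall>z. \<exists>w. freq_norm w = freq_norm z \<and> (AE x in M. cnj (\<psi> z x) = \<psi> w x)"
    and "wspace M \<psi> b \<subseteq> wspace M \<psi> a"
    and nondegenerate: "b 0 > 1"
  shows
    "(cutoff_sum b \<in> \<Omega>(\<lambda>\<zeta>. \<zeta> ^ (2 * CARD('d))) \<longrightarrow>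
       (\<forall>\<zeta> :: nat \<Rightarrow> real.
          filterlim \<zeta> at_top sequentially \<and>
          (\<lambda>n. (cutoff_sum b (\<zeta> n))\<^sup>2) \<in> \<Theta>(\<lambda>n. \<zeta> n ^ CARD('d) * (real n)\<^sup>2) \<longrightarrow>
          (\<exists>c>0. \<forall>\<^sub>F n in sequentially.
             minimax_risk M \<psi> a b n \<ge>
               ennreal (c * max ((cutoff_sum a (\<zeta> n))\<^sup>2 / (cutoff_sum b (\<zeta> n))\<^sup>2)
                                (1 / real n))))) \<and>
     (cutoff_sum b \<in> o(\<lambda>\<zeta>. \<zeta> ^ (2 * CARD('d))) \<longrightarrow>
       (\<exists>c>0. \<forall>\<^sub>F n in sequentially.
          minimax_risk M \<psi> a b n \<ge>
            ennreal (c * max ((cutoff_sum a (real n powr (2 / (3 * real CARD('d)))))\<^sup>2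
                                / real n powr (8 / 3))
                             (1 / real n))))"
proof (intro conjI impI allI)
  obtain C \<sigma> where conj_basis: "conj_basis M \<psi> C \<sigma> 0"
    and sym: "\<And>z :: int ^ 'd. freq_norm (\<sigma> z) = freq_norm z"
    using conj_basis_exists[OF assms(2,3) basis psi_zero bounded conjugation] by blast
  obtain z1 :: "int ^ 'd" where "z1 \<noteq> 0" using exists_nonzero_frequency by blast
  then have root_n: "\<exists>c>0. \<forall>\<^sub>F n in sequentially. ennreal (c * (1 / real n)) \<le> minimax_risk M \<psi> a b n"
    using conj_basis.eventually_minimax_risk_ge_parametric[where a = a and b = b, OF conj_basis] assms(4) nondegenerate
    by blast
  note signs = eventually_minimax_risk_ge_signs[where b = b, OF conj_basis sym assms(4) nondegenerate]
  {
    fix \<zeta> :: "nat \<Rightarrow> real"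
    assume \<Omega>: "cutoff_sum b \<in> \<Omega>(\<lambda>\<zeta>. \<zeta> ^ (2 * CARD('d)))"
      and "filterlim \<zeta> at_top sequentially \<and>
          (\<lambda>n. (cutoff_sum b (\<zeta> n))\<^sup>2) \<in> \<Theta>(\<lambda>n. \<zeta> n ^ CARD('d) * (real n)\<^sup>2)"
    then have \<zeta>: "filterlim \<zeta> at_top sequentially"
      and \<Theta>: "(\<lambda>n. (cutoff_sum b (\<zeta> n))\<^sup>2) \<in> \<Omega>(\<lambda>n. \<zeta> n ^ CARD('d) * (real n)\<^sup>2)" by auto
    have "(\<lambda>n. cutoff_sum b (\<zeta> n)) \<in> \<Omega>(\<lambda>n. \<zeta> n ^ (2 * CARD('d)))"
      using landau_omega.big.compose[OF \<Omega> \<zeta>] .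
    then obtain c1 where c1: "c1 > 0"
      and e1: "\<forall>\<^sub>F n in sequentially. norm (cutoff_sum b (\<zeta> n)) \<ge> c1 * norm (\<zeta> n ^ (2 * CARD('d)))"
      by (rule landau_omega.bigE)
    from \<Theta> obtain c2 where c2: "c2 > 0"
      and e2: "\<forall>\<^sub>F n in sequentially. norm ((cutoff_sum b (\<zeta> n))\<^sup>2) \<ge> c2 * norm (\<zeta> n ^ CARD('d) * (real n)\<^sup>2)"
      by (rule landau_omega.bigE)
    have e0: "\<forall>\<^sub>F n in sequentially. 0 \<le> \<zeta> n" using \<zeta> by (simp add: filterlim_at_top)
    \<comment> \<open>Up to a constant, the largest coefficient that the ball allows. Positivity then follows from
      the growth assumption on \<open>b\<close>, and indistinguishability from the choice of \<open>\<zeta>\<close>.\<close>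
    define \<gamma> where "\<gamma> n = 1 / sqrt (cutoff_sum b (\<zeta> n))" for n
    define K where "K = max (1 / sqrt c1) (max 1 (1 / c2))"
    have "\<forall>\<^sub>F n in sequentially. 0 \<le> \<gamma> n \<and> \<gamma> n * \<zeta> n ^ CARD('d) \<le> K \<and> (\<gamma> n)\<^sup>2 * cutoff_sum b (\<zeta> n) \<le> K
          \<and> (real n)\<^sup>2 * \<gamma> n ^ 4 * \<zeta> n ^ CARD('d) \<le> K"
      using e0 e1 e2
    proof eventually_elim
      case (elim n)
      define B where "B = cutoff_sum b (\<zeta> n)"
      define t where "t = \<zeta> n ^ CARD('d)"
      have B: "0 < B" unfolding B_def using elim(1) assms(5) by (intro cutoff_sum_pos) auto
      have t: "0 \<le> t" using elim(1) by (simp add: t_def)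
      have b1: "c1 * t\<^sup>2 \<le> B" using elim(1,2) B by (simp add: B_def t_def power_mult mult.commute flip: power_mult)
      have b2: "c2 * (t * (real n)\<^sup>2) \<le> B\<^sup>2" using elim(1,3) by (simp add: B_def t_def)
      have \<gamma>2: "(\<gamma> n)\<^sup>2 = 1 / B" using B by (simp add: \<gamma>_def B_def power_divide)
      have "\<gamma> n ^ 4 = ((\<gamma> n)\<^sup>2)\<^sup>2" by (simp flip: power_mult)
      then have \<gamma>4: "\<gamma> n ^ 4 = 1 / B\<^sup>2" by (simp add: \<gamma>2 power_divide)
      have "sqrt (c1 * t\<^sup>2) \<le> sqrt B" using b1 by simp
      then have "\<gamma> n * t \<le> 1 / sqrt c1"
        using B c1 t by (simp add: \<gamma>_def B_def real_sqrt_mult field_simps)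
      moreover have "(real n)\<^sup>2 * \<gamma> n ^ 4 * t \<le> 1 / c2"
        using b2 B c2 by (simp add: \<gamma>4 field_simps)
      moreover have "0 \<le> \<gamma> n" using B by (simp add: \<gamma>_def B_def)
      moreover have "(\<gamma> n)\<^sup>2 * B \<le> 1" using B by (simp add: \<gamma>2)
      ultimately show ?case by (auto simp: K_def t_def B_def le_max_iff_disj)
    qed
    from signs[OF \<zeta> this] obtain c where "c > 0"
      and ev: "\<forall>\<^sub>F n in sequentially. ennreal (c * (\<gamma> n ^ 4 * (cutoff_sum a (\<zeta> n))\<^sup>2)) \<le> minimax_risk M \<psi> a b n"
      by blast
    have "\<gamma> n ^ 4 = 1 / (cutoff_sum b (\<zeta> n))\<^sup>2" for n
    proof -
      have "\<gamma> n ^ 4 = ((\<gamma> n)\<^sup>2)\<^sup>2" by (simp flip: power_mult)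
      then show ?thesis by (simp add: \<gamma>_def power_divide cutoff_sum_nonneg)
    qed
    with ev have "\<forall>\<^sub>F n in sequentially.
        ennreal (c * ((cutoff_sum a (\<zeta> n))\<^sup>2 / (cutoff_sum b (\<zeta> n))\<^sup>2)) \<le> minimax_risk M \<psi> a b n" by simp
    with \<open>c > 0\<close> root_n
    show "\<exists>c>0. \<forall>\<^sub>F n in sequentially. minimax_risk M \<psi> a b n \<ge>
             ennreal (c * max ((cutoff_sum a (\<zeta> n))\<^sup>2 / (cutoff_sum b (\<zeta> n))\<^sup>2) (1 / real n))"
      by (intro eventually_ennreal_max) auto
  next
    assume o: "cutoff_sum b \<in> o(\<lambda>\<zeta>. \<zeta> ^ (2 * CARD('d)))"
    \<comment> \<open>Here positivity and indistinguishability are the binding constraints. Equality in both,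
      \<open>\<gamma> * \<zeta> ^ CARD('d) = 1\<close> and \<open>n\<^sup>2 * \<gamma> ^ 4 * \<zeta> ^ CARD('d) = 1\<close>, determines \<open>\<zeta>\<close> and \<open>\<gamma>\<close>; the ball
      constraint then follows from the growth assumption on \<open>b\<close>.\<close>
    define \<zeta> where "\<zeta> n = real n powr (2 / (3 * real CARD('d)))" for n
    define \<gamma> where "\<gamma> n = real n powr (- (2 / 3))" for n
    have \<gamma>4: "\<gamma> n ^ 4 = real n powr (- (8 / 3))" if "0 < n" for n
      using that by (simp add: \<gamma>_def powr_power)
    have \<zeta>: "filterlim \<zeta> at_top sequentially"
    proof -
      have "filterlim (\<lambda>n. exp (2 / (3 * real CARD('d)) * ln (real n))) at_top sequentially"
        by (intro filterlim_compose[OF exp_at_top] filterlim_tendsto_pos_mult_at_top[OF tendsto_const]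
            filterlim_compose[OF ln_at_top] filterlim_real_sequentially) simp
      moreover have "\<forall>\<^sub>F n in sequentially. exp (2 / (3 * real CARD('d)) * ln (real n)) = \<zeta> n"
        using eventually_gt_at_top[of 0] by eventually_elim (simp add: \<zeta>_def powr_def)
      ultimately show ?thesis by (simp cong: filterlim_cong)
    qed
    have "(\<lambda>n. cutoff_sum b (\<zeta> n)) \<in> o(\<lambda>n. \<zeta> n ^ (2 * CARD('d)))"
      using landau_o.small.compose[OF o \<zeta>] .
    then have "\<forall>\<^sub>F n in sequentially. norm (cutoff_sum b (\<zeta> n)) \<le> 1 * norm (\<zeta> n ^ (2 * CARD('d)))"
      by (rule landau_o.smallD) simp
    then have "\<forall>\<^sub>F n in sequentially. 0 \<le> \<gamma> n \<and> \<gamma> n * \<zeta> n ^ CARD('d) \<le> 1 \<and> (\<gamma> n)\<^sup>2 * cutoff_sum b (\<zeta> n) \<le> 1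
          \<and> (real n)\<^sup>2 * \<gamma> n ^ 4 * \<zeta> n ^ CARD('d) \<le> 1"
      using eventually_gt_at_top[of 0]
    proof eventually_elim
      case (elim n)
      have t: "\<zeta> n ^ CARD('d) = real n powr (2 / 3)"
        using elim(2) by (simp add: \<zeta>_def powr_power)
      have one: "\<gamma> n * \<zeta> n ^ CARD('d) = 1"
        using elim(2) by (simp add: t \<gamma>_def powr_minus)
      have "cutoff_sum b (\<zeta> n) \<le> (\<zeta> n ^ CARD('d))\<^sup>2"
        using elim(1) by (simp add: mult.commute \<zeta>_def flip: power_mult)
      then have "(\<gamma> n)\<^sup>2 * cutoff_sum b (\<zeta> n) \<le> (\<gamma> n)\<^sup>2 * (\<zeta> n ^ CARD('d))\<^sup>2"
        by (intro mult_left_mono) auto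
      also have "\<dots> = 1" using one by (simp flip: power_mult_distrib)
      finally have "(\<gamma> n)\<^sup>2 * cutoff_sum b (\<zeta> n) \<le> 1" .
      moreover have "(real n)\<^sup>2 * \<gamma> n ^ 4 * \<zeta> n ^ CARD('d) = 1"
      proof -
        have "(real n)\<^sup>2 = real n powr 2" using elim(2) by simp
        with \<gamma>4[OF elim(2)] have "(real n)\<^sup>2 * \<gamma> n ^ 4 * \<zeta> n ^ CARD('d) = real n powr (2 + - (8 / 3) + 2 / 3)"
          unfolding t by (simp only: powr_add)
        then show ?thesis using elim(2) by simp
      qed
      ultimately show ?case using one by (simp add: \<gamma>_def)
    qed
    from signs[OF \<zeta> this] obtain c where "c > 0"
      and ev: "\<forall>\<^sub>F n in sequentially. ennreal (c * (\<gamma> n ^ 4 * (cutoff_sum a (\<zeta> n))\<^sup>2)) \<le> minimax_risk M \<psi> a b n"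
      by blast
    have "\<forall>\<^sub>F n in sequentially. ennreal (c * ((cutoff_sum a (\<zeta> n))\<^sup>2 / real n powr (8 / 3))) \<le> minimax_risk M \<psi> a b n"
      using ev eventually_gt_at_top[of 0]
    proof eventually_elim
      case (elim n)
      have "\<gamma> n ^ 4 = 1 / real n powr (8 / 3)"
        using elim(2) by (simp add: \<gamma>4 powr_minus_divide)
      with elim(1) show ?case by simp
    qed
    with \<open>c > 0\<close> root_n
    show "\<exists>c>0. \<forall>\<^sub>F n in sequentially. minimax_risk M \<psi> a b n \<ge>
            ennreal (c * max ((cutoff_sum a (real n powr (2 / (3 * real CARD('d)))))\<^sup>2
                                / real n powr (8 / 3)) (1 / real n))"
      unfolding \<zeta>_def by (intro eventually_ennreal_max) auto
  }
qed

end
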